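(* Consider closed formulas of interpretability logic \textbf{IL} (no propositional variables). For an alphabet, let $\mathcal F_n$ be the set of closed formulas with exactly $n$ connectives, and for a class $G$ of formulas let $\mu_G=\lim_{n\to\infty}\#(G\cap\mathcal F_n)/\#\mathcal F_n$. Then, with the class $G$ of "\textbf{GL}-like" formulas defined in the context for each alphabet: (a) if the alphabet is $\{\bot,\rightarrow,\rhd\}$, then the limit $\mu_G$ exists and $\mu_G=0.93771\ldots$; (b) if the alphabet is $\{\bot,\rightarrow,\rhd,\Box\}$, then the limit $\mu_G$ exists and $\mu_G=0.86653\ldots$; (c) if the alphabet is $\{\bot,\top,\rightarrow,\rhd,\Box\}$, then the limit $\mu_G$ exists and $\mu_G=0.90519\ldots$.
   Context: Here $\rightarrow,\rhd$ are binary connectives, $\Box$ is unary, $\bot,\top$ are primitive symbols; complexity = number of connectives. In a production each class letter on the right stands for a formula of that class of smaller complexity. Alphabet $\{\bot,\rightarrow,\rhd\}$: all formulas $F::=\bot\mid F\rightarrow F\mid F\rhd F$; affirmative $A::=F\rhd F\mid N\rightarrow F\mid F\rightarrow A$; negative $N::=\bot\mid A\rightarrow N$; direct $M::=A\rhd N$; cross $X::=M\rightarrow\bot$. Basic locally GL-like formulas $B$ are the formulas of one of the forms $\bot\rhd F$, $F\rhd A$, $A\rhd\bot$, $N\rhd X$, $X\rhd\bot$. Locally GL-like $L::=\bot\mid B\mid L\rightarrow L$. GL-like $G::=L\mid N\mid M\mid (G\rightarrow\bot)\rhd\bot$. Alphabet $\{\bot,\rightarrow,\rhd,\Box\}$: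 $F::=\bot\mid\Box F\mid F\rightarrow F\mid F\rhd F$; $N::=\bot\mid A\rightarrow N$; $A::=\Box F\mid N\rightarrow F\mid F\rightarrow A\mid F\rhd F$; $M::=\Box N\mid A\rhd N$; $X::=M\rightarrow\bot$; $B$ consists of formulas of the forms $\Box N$, $\Box M$, $\bot\rhd F$, $F\rhd A$, $A\rhd\bot$, $N\rhd X$, $X\rhd\bot$; $L::=\bot\mid B\mid L\rightarrow L$; $G::=L\mid N\mid M\mid\Box G\mid(G\rightarrow\bot)\rhd\bot$. Alphabet $\{\bot,\top,\rightarrow,\rhd,\Box\}$: $F::=\bot\mid\top\mid\Box F\mid F\rightarrow F\mid F\rhd F$; $N::=\bot\mid A\rightarrow N$; $A::=\top\mid\Box F\mid N\rightarrow F\mid F\rightarrow A\mid F\rhd F$; $M::=\Box N\mid A\rhd N$; $X::=M\rightarrow\bot$; $B$ as in the previous alphabet; $L::=\bot\mid\top\mid B\mid F\rightarrow\top\mid L\rightarrow L$; $G::=L\mid N\mid M\mid\Box G\mid(G\rightarrow\bot)\rhd\bot\mid\top\rightarrow G$. *)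

theory Defs
  imports Complex_Main
begin

datatype fm =
    Bot  ("\<^bold>\<bottom>")
  | Top  ("\<^bold>\<top>")
  | Box fm  ("\<^bold>\<box> _" [70] 70)
  | Imp fm fm  (infixr "\<^bold>\<rightarrow>" 55)
  | Rhd fm fm  (infix "\<^bold>\<rhd>" 60)

(* The primitive symbols Bot and Top do not count as connectives. *)
primrec complexity :: "fm \<Rightarrow> nat" where
  "complexity \<^bold>\<bottom> = 0"
| "complexity \<^bold>\<top> = 0"
| "complexity (\<^bold>\<box> p) = Suc (complexity p)"
| "complexity (p \<^bold>\<rightarrow> q) = Suc (complexity p + complexity q)"
| "complexity (p \<^bold>\<rhd> q) = Suc (complexity p + complexity q)"

definition level :: "fm set \<Rightarrow> nat \<Rightarrow> fm set" where
  "level F n = {p \<in> F. complexity p = n}"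

definition has_density :: "fm set \<Rightarrow> fm set \<Rightarrow> real \<Rightarrow> bool" where
  "has_density F G d \<longleftrightarrow>
     (\<lambda>n. real (card (G \<inter> level F n)) / real (card (level F n))) \<longlonglongrightarrow> d"

(* One grammar per alphabet, with suffix ir, irb or tirb for the symbols present besides Bot
   (Imp, Rhd, Box, Top). A set contains exactly the formulas derivable from the corresponding
   class letter: F all formulas, A affirmative, N negative, M direct, X cross, B basic locally
   GL-like, L locally GL-like, G GL-like. *)

inductive_set F_ir :: "fm set" where
  "\<^bold>\<bottom> \<in> F_ir"
| "p \<in> F_ir \<Longrightarrow> q \<in> F_ir \<Longrightarrow> p \<^bold>\<rightarrow> q \<in> F_ir"
| "p \<in> F_ir \<Longrightarrow> q \<in> F_ir \<Longrightarrow> p \<^bold>\<rhd> q \<in> F_ir"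

inductive_set A_ir :: "fm set" and N_ir :: "fm set" where
  "p \<in> F_ir \<Longrightarrow> q \<in> F_ir \<Longrightarrow> p \<^bold>\<rhd> q \<in> A_ir"
| "p \<in> N_ir \<Longrightarrow> q \<in> F_ir \<Longrightarrow> p \<^bold>\<rightarrow> q \<in> A_ir"
| "p \<in> F_ir \<Longrightarrow> q \<in> A_ir \<Longrightarrow> p \<^bold>\<rightarrow> q \<in> A_ir"
| "\<^bold>\<bottom> \<in> N_ir"
| "p \<in> A_ir \<Longrightarrow> q \<in> N_ir \<Longrightarrow> p \<^bold>\<rightarrow> q \<in> N_ir"

inductive_set M_ir :: "fm set" where
  "p \<in> A_ir \<Longrightarrow> q \<in> N_ir \<Longrightarrow> p \<^bold>\<rhd> q \<in> M_ir"

inductive_set X_ir :: "fm set" where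
  "p \<in> M_ir \<Longrightarrow> p \<^bold>\<rightarrow> \<^bold>\<bottom> \<in> X_ir"

inductive_set B_ir :: "fm set" where
  "p \<in> F_ir \<Longrightarrow> \<^bold>\<bottom> \<^bold>\<rhd> p \<in> B_ir"
| "p \<in> F_ir \<Longrightarrow> q \<in> A_ir \<Longrightarrow> p \<^bold>\<rhd> q \<in> B_ir"
| "p \<in> A_ir \<Longrightarrow> p \<^bold>\<rhd> \<^bold>\<bottom> \<in> B_ir"
| "p \<in> N_ir \<Longrightarrow> q \<in> X_ir \<Longrightarrow> p \<^bold>\<rhd> q \<in> B_ir"
| "p \<in> X_ir \<Longrightarrow> p \<^bold>\<rhd> \<^bold>\<bottom> \<in> B_ir"

inductive_set L_ir :: "fm set" where
  "\<^bold>\<bottom> \<in> L_ir"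
| "p \<in> B_ir \<Longrightarrow> p \<in> L_ir"
| "p \<in> L_ir \<Longrightarrow> q \<in> L_ir \<Longrightarrow> p \<^bold>\<rightarrow> q \<in> L_ir"

inductive_set G_ir :: "fm set" where
  "p \<in> L_ir \<Longrightarrow> p \<in> G_ir"
| "p \<in> N_ir \<Longrightarrow> p \<in> G_ir"
| "p \<in> M_ir \<Longrightarrow> p \<in> G_ir"
| "p \<in> G_ir \<Longrightarrow> (p \<^bold>\<rightarrow> \<^bold>\<bottom>) \<^bold>\<rhd> \<^bold>\<bottom> \<in> G_ir"

inductive_set F_irb :: "fm set" where
  "\<^bold>\<bottom> \<in> F_irb"
| "p \<in> F_irb \<Longrightarrow> \<^bold>\<box> p \<in> F_irb"
| "p \<in> F_irb \<Longrightarrow> q \<in> F_irb \<Longrightarrow> p \<^bold>\<rightarrow> q \<in> F_irb"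
| "p \<in> F_irb \<Longrightarrow> q \<in> F_irb \<Longrightarrow> p \<^bold>\<rhd> q \<in> F_irb"

inductive_set A_irb :: "fm set" and N_irb :: "fm set" where
  "p \<in> F_irb \<Longrightarrow> \<^bold>\<box> p \<in> A_irb"
| "p \<in> N_irb \<Longrightarrow> q \<in> F_irb \<Longrightarrow> p \<^bold>\<rightarrow> q \<in> A_irb"
| "p \<in> F_irb \<Longrightarrow> q \<in> A_irb \<Longrightarrow> p \<^bold>\<rightarrow> q \<in> A_irb"
| "p \<in> F_irb \<Longrightarrow> q \<in> F_irb \<Longrightarrow> p \<^bold>\<rhd> q \<in> A_irb"
| "\<^bold>\<bottom> \<in> N_irb"
| "p \<in> A_irb \<Longrightarrow> q \<in> N_irb \<Longrightarrow> p \<^bold>\<rightarrow> q \<in> N_irb"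

inductive_set M_irb :: "fm set" where
  "p \<in> N_irb \<Longrightarrow> \<^bold>\<box> p \<in> M_irb"
| "p \<in> A_irb \<Longrightarrow> q \<in> N_irb \<Longrightarrow> p \<^bold>\<rhd> q \<in> M_irb"

inductive_set X_irb :: "fm set" where
  "p \<in> M_irb \<Longrightarrow> p \<^bold>\<rightarrow> \<^bold>\<bottom> \<in> X_irb"

inductive_set B_irb :: "fm set" where
  "p \<in> N_irb \<Longrightarrow> \<^bold>\<box> p \<in> B_irb"
| "p \<in> M_irb \<Longrightarrow> \<^bold>\<box> p \<in> B_irb"
| "p \<in> F_irb \<Longrightarrow> \<^bold>\<bottom> \<^bold>\<rhd> p \<in> B_irb"
| "p \<in> F_irb \<Longrightarrow> q \<in> A_irb \<Longrightarrow> p \<^bold>\<rhd> q \<in> B_irb"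
| "p \<in> A_irb \<Longrightarrow> p \<^bold>\<rhd> \<^bold>\<bottom> \<in> B_irb"
| "p \<in> N_irb \<Longrightarrow> q \<in> X_irb \<Longrightarrow> p \<^bold>\<rhd> q \<in> B_irb"
| "p \<in> X_irb \<Longrightarrow> p \<^bold>\<rhd> \<^bold>\<bottom> \<in> B_irb"

inductive_set L_irb :: "fm set" where
  "\<^bold>\<bottom> \<in> L_irb"
| "p \<in> B_irb \<Longrightarrow> p \<in> L_irb"
| "p \<in> L_irb \<Longrightarrow> q \<in> L_irb \<Longrightarrow> p \<^bold>\<rightarrow> q \<in> L_irb"

inductive_set G_irb :: "fm set" where
  "p \<in> L_irb \<Longrightarrow> p \<in> G_irb"
| "p \<in> N_irb \<Longrightarrow> p \<in> G_irb"
| "p \<in> M_irb \<Longrightarrow> p \<in> G_irb"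
| "p \<in> G_irb \<Longrightarrow> \<^bold>\<box> p \<in> G_irb"
| "p \<in> G_irb \<Longrightarrow> (p \<^bold>\<rightarrow> \<^bold>\<bottom>) \<^bold>\<rhd> \<^bold>\<bottom> \<in> G_irb"

inductive_set F_tirb :: "fm set" where
  "\<^bold>\<bottom> \<in> F_tirb"
| "\<^bold>\<top> \<in> F_tirb"
| "p \<in> F_tirb \<Longrightarrow> \<^bold>\<box> p \<in> F_tirb"
| "p \<in> F_tirb \<Longrightarrow> q \<in> F_tirb \<Longrightarrow> p \<^bold>\<rightarrow> q \<in> F_tirb"
| "p \<in> F_tirb \<Longrightarrow> q \<in> F_tirb \<Longrightarrow> p \<^bold>\<rhd> q \<in> F_tirb"

inductive_set A_tirb :: "fm set" and N_tirb :: "fm set" where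
  "\<^bold>\<top> \<in> A_tirb"
| "p \<in> F_tirb \<Longrightarrow> \<^bold>\<box> p \<in> A_tirb"
| "p \<in> N_tirb \<Longrightarrow> q \<in> F_tirb \<Longrightarrow> p \<^bold>\<rightarrow> q \<in> A_tirb"
| "p \<in> F_tirb \<Longrightarrow> q \<in> A_tirb \<Longrightarrow> p \<^bold>\<rightarrow> q \<in> A_tirb"
| "p \<in> F_tirb \<Longrightarrow> q \<in> F_tirb \<Longrightarrow> p \<^bold>\<rhd> q \<in> A_tirb"
| "\<^bold>\<bottom> \<in> N_tirb"
| "p \<in> A_tirb \<Longrightarrow> q \<in> N_tirb \<Longrightarrow> p \<^bold>\<rightarrow> q \<in> N_tirb"

inductive_set M_tirb :: "fm set" where
  "p \<in> N_tirb \<Longrightarrow> \<^bold>\<box> p \<in> M_tirb"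
| "p \<in> A_tirb \<Longrightarrow> q \<in> N_tirb \<Longrightarrow> p \<^bold>\<rhd> q \<in> M_tirb"

inductive_set X_tirb :: "fm set" where
  "p \<in> M_tirb \<Longrightarrow> p \<^bold>\<rightarrow> \<^bold>\<bottom> \<in> X_tirb"

inductive_set B_tirb :: "fm set" where
  "p \<in> N_tirb \<Longrightarrow> \<^bold>\<box> p \<in> B_tirb"
| "p \<in> M_tirb \<Longrightarrow> \<^bold>\<box> p \<in> B_tirb"
| "p \<in> F_tirb \<Longrightarrow> \<^bold>\<bottom> \<^bold>\<rhd> p \<in> B_tirb"
| "p \<in> F_tirb \<Longrightarrow> q \<in> A_tirb \<Longrightarrow> p \<^bold>\<rhd> q \<in> B_tirb"
| "p \<in> A_tirb \<Longrightarrow> p \<^bold>\<rhd> \<^bold>\<bottom> \<in> B_tirb"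
| "p \<in> N_tirb \<Longrightarrow> q \<in> X_tirb \<Longrightarrow> p \<^bold>\<rhd> q \<in> B_tirb"
| "p \<in> X_tirb \<Longrightarrow> p \<^bold>\<rhd> \<^bold>\<bottom> \<in> B_tirb"

inductive_set L_tirb :: "fm set" where
  "\<^bold>\<bottom> \<in> L_tirb"
| "\<^bold>\<top> \<in> L_tirb"
| "p \<in> B_tirb \<Longrightarrow> p \<in> L_tirb"
| "p \<in> F_tirb \<Longrightarrow> p \<^bold>\<rightarrow> \<^bold>\<top> \<in> L_tirb"
| "p \<in> L_tirb \<Longrightarrow> q \<in> L_tirb \<Longrightarrow> p \<^bold>\<rightarrow> q \<in> L_tirb"

inductive_set G_tirb :: "fm set" where
  "p \<in> L_tirb \<Longrightarrow> p \<in> G_tirb"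
| "p \<in> N_tirb \<Longrightarrow> p \<in> G_tirb"
| "p \<in> M_tirb \<Longrightarrow> p \<in> G_tirb"
| "p \<in> G_tirb \<Longrightarrow> \<^bold>\<box> p \<in> G_tirb"
| "p \<in> G_tirb \<Longrightarrow> (p \<^bold>\<rightarrow> \<^bold>\<bottom>) \<^bold>\<rhd> \<^bold>\<bottom> \<in> G_tirb"
| "p \<in> G_tirb \<Longrightarrow> \<^bold>\<top> \<^bold>\<rightarrow> p \<in> G_tirb"

end

theory Submission
  imports Defs "HOL-Computational_Algebra.Formal_Power_Series"
begin

text \<open>
  Let \<open>\<rho>\<close> be the radius of convergence of the generating function \<open>F\<close> of all formulas, for which
  \<open>F = t + s x F + 2 x F\<^sup>2\<close>. The coefficients satisfy \<open>f n / f (n + 1) \<longlonglongrightarrow> \<rho>\<close>, the series converges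
  at \<open>\<rho>\<close>, and \<open>(f * f) n / f n \<longlonglongrightarrow> 2 F(\<rho>)\<close>. Hence if \<open>a n / f n \<longlonglongrightarrow> \<alpha>\<close> and \<open>b n / f n \<longlonglongrightarrow> \<beta>\<close> with
  \<open>0 \<le> a, b \<le> f\<close>, then \<open>(a * b) n / f n \<longlonglongrightarrow> \<alpha> B(\<rho>) + \<beta> A(\<rho>)\<close>. Each class of formulas is a disjoint
  union of products of classes, so the limits of its density solve a linear equation with
  coefficients given by generating functions at \<open>\<rho>\<close>. For a recursively defined class the same
  product rule with error terms is a contraction, because \<open>\<rho> F(\<rho>) \<le> 1/4\<close>; thus the limit exists.
  The values at \<open>\<rho>\<close> are roots of quadratic equations and are enclosed in rational intervals.
\<close>

section \<open>Sequences compared with a subexponential sequence\<close>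

text \<open>At \<rho> the generating function F has a square-root branch point: the derivative of
  \<open>t + s x F + 2 x F^2\<close> with respect to F is
  \<open>s \<rho> + 4 \<rho> F(\<rho>) = 1\<close> there. Singularity analysis would read off the
  density of a class S as the value of dS/dF at this point; the product rule for limits is an
  elementary substitute. The derivative condition is what makes the two halves fit: the recurrence
  turns \<open>(f * f) n / f n\<close> into \<open>(f (n + 1) / f n - s) / 2\<close>, and
  \<open>(1/\<rho> - s) / 2\<close> is exactly \<open>2 F(\<rho>)\<close>. The obstacle is the ratio
  limit. The quadratic recurrence alone would be circular, since it expresses the ratio by the very
  convolution quotient that is to be controlled. The way out is that an algebraic function also
  satisfies a linear differential equation, so the coefficients obey a linear recurrence of order
  two, from which consecutive ratios can be followed.\<close>

text \<open>\<open>near u l e\<close> expresses \<open>limsup \<bar>u n - l\<bar> \<le> e\<close>. Carrying the error \<open>e\<close> along lets the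
  existence of a limit be derived from a contraction estimate.\<close>

definition near :: "(nat \<Rightarrow> real) \<Rightarrow> real \<Rightarrow> real \<Rightarrow> bool" where
  "near u l e \<longleftrightarrow> (\<forall>\<epsilon>>0. \<forall>\<^sub>F n in sequentially. \<bar>u n - l\<bar> \<le> e + \<epsilon>)"

lemma near_zero_iff: "near u l 0 \<longleftrightarrow> u \<longlonglongrightarrow> l"
proof
  assume n: "near u l 0"
  show "u \<longlonglongrightarrow> l"
  proof (rule tendstoI)
    fix \<epsilon> :: real assume "\<epsilon> > 0"
    then have "\<forall>\<^sub>F n in sequentially. \<bar>u n - l\<bar> \<le> 0 + \<epsilon>/2"
      using n unfolding near_def by (meson half_gt_zero)
    then show "\<forall>\<^sub>F n in sequentially. dist (u n) l < \<epsilon>"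
      by eventually_elim (use \<open>\<epsilon> > 0\<close> in \<open>simp add: dist_real_def\<close>)
  qed
next
  assume t: "u \<longlonglongrightarrow> l"
  show "near u l 0"
    unfolding near_def
  proof (intro allI impI)
    fix \<epsilon> :: real assume "\<epsilon> > 0"
    from tendstoD[OF t this] show "\<forall>\<^sub>F n in sequentially. \<bar>u n - l\<bar> \<le> 0 + \<epsilon>"
      by eventually_elim (simp add: dist_real_def)
  qed
qed

lemma near_add:
  assumes "near u l d" "near v m e"
  shows "near (\<lambda>n. u n + v n) (l + m) (d + e)"
  unfolding near_def
proof (intro allI impI)
  fix \<epsilon> :: real assume "\<epsilon> > 0"
  then have "\<forall>\<^sub>F n in sequentially. \<bar>u n - l\<bar> \<le> d + \<epsilon>/2" "\<forall>\<^sub>F n in sequentially. \<bar>v n - m\<bar> \<le> e + \<epsilon>/2"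
    using assms unfolding near_def by (meson half_gt_zero)+
  then show "\<forall>\<^sub>F n in sequentially. \<bar>u n + v n - (l + m)\<bar> \<le> d + e + \<epsilon>"
    by eventually_elim linarith
qed

lemma near_minus:
  assumes "near u l e" shows "near (\<lambda>n. - u n) (- l) e"
  using assms unfolding near_def by (simp add: abs_minus_commute)

lemma near_mult_tendsto:
  assumes u: "near u l e" and v: "v \<longlonglongrightarrow> r" and e: "0 \<le> e"
  shows "near (\<lambda>n. u n * v n) (l * r) (e * \<bar>r\<bar>)"
  unfolding near_def
proof (intro allI impI)
  fix \<epsilon> :: real assume "\<epsilon> > 0"
  \<comment> \<open>\<open>D\<close> collects the coefficients of \<open>\<delta>\<close> in the
    expanded error below, once \<open>\<delta> * \<delta>\<close> is bounded by
    \<open>\<delta>\<close>.\<close>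
  define D where "D = \<bar>r\<bar> + e + 1 + \<bar>l\<bar>"
  have D: "D > 0" using e unfolding D_def by simp
  define \<delta> where "\<delta> = min 1 (\<epsilon> / D)"
  have \<delta>: "\<delta> > 0" "\<delta> \<le> 1" "\<delta> * D \<le> \<epsilon>"
    using D \<open>\<epsilon> > 0\<close> by (auto simp: \<delta>_def min_def field_simps)
  have "\<forall>\<^sub>F n in sequentially. \<bar>u n - l\<bar> \<le> e + \<delta>" using u \<delta>(1) unfolding near_def by blast
  moreover have "\<forall>\<^sub>F n in sequentially. \<bar>v n - r\<bar> < \<delta>"
    using tendstoD[OF v \<delta>(1)] by (simp add: dist_real_def)
  ultimately show "\<forall>\<^sub>F n in sequentially. \<bar>u n * v n - l * r\<bar> \<le> e * \<bar>r\<bar> + \<epsilon>"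
  proof eventually_elim
    case (elim n)
    have "u n * v n - l * r = (u n - l) * v n + l * (v n - r)" by (simp add: algebra_simps)
    then have "\<bar>u n * v n - l * r\<bar> \<le> \<bar>u n - l\<bar> * \<bar>v n\<bar> + \<bar>l\<bar> * \<bar>v n - r\<bar>"
      by (metis abs_mult abs_triangle_ineq)
    also have "\<dots> \<le> (e + \<delta>) * (\<bar>r\<bar> + \<delta>) + \<bar>l\<bar> * \<delta>"
      using elim e \<delta> by (intro add_mono mult_mono) auto
    also have "\<dots> = e * \<bar>r\<bar> + (e * \<delta> + \<delta> * \<bar>r\<bar> + \<delta> * \<delta> + \<bar>l\<bar> * \<delta>)" by (simp add: algebra_simps)
    also have "\<dots> \<le> e * \<bar>r\<bar> + \<delta> * D"
    proof -
      have "\<delta> * \<delta> \<le> \<delta> * 1" using \<delta> by (intro mult_left_mono) auto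
      then show ?thesis unfolding D_def by (simp add: algebra_simps)
    qed
    finally show ?case using \<delta>(3) by linarith
  qed
qed

text \<open>Any finite initial error can be improved to \<open>c ^ k * E\<close> for every
  \<open>k\<close>. The candidate limit \<open>l\<close> is known beforehand; only convergence to it
  is at stake.\<close>

lemma near_contraction:
  assumes c: "0 \<le> c" "c < 1" and E: "0 \<le> E" "near u l E"
    and step: "\<And>e. 0 \<le> e \<Longrightarrow> near u l e \<Longrightarrow> near u l (c * e)"
  shows "u \<longlonglongrightarrow> l"
proof -
  have *: "near u l (c ^ k * E)" for k
  proof (induction k)
    case (Suc k)
    then show ?case using step[of "c ^ k * E"] c E(1) by (simp add: mult.assoc)
  qed (use E in simp)
  have lim: "(\<lambda>k. c ^ k * E) \<longlonglongrightarrow> 0"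
    using LIMSEQ_power_zero[of c] c by (auto intro!: tendsto_mult_left_zero)
  have "near u l 0"
    unfolding near_def
  proof (intro allI impI)
    fix \<epsilon> :: real assume "\<epsilon> > 0"
    then have "\<forall>\<^sub>F k in sequentially. c ^ k * E < \<epsilon>/2" using lim by (intro order_tendstoD) auto
    then obtain k where k: "c ^ k * E < \<epsilon>/2" by (auto simp: eventually_sequentially)
    have "\<forall>\<^sub>F n in sequentially. \<bar>u n - l\<bar> \<le> c ^ k * E + \<epsilon>/2"
      using *[of k] \<open>\<epsilon> > 0\<close> unfolding near_def by (meson half_gt_zero)
    then show "\<forall>\<^sub>F n in sequentially. \<bar>u n - l\<bar> \<le> 0 + \<epsilon>"
      by eventually_elim (use k in linarith)
  qed
  then show ?thesis by (simp add: near_zero_iff)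
qed

section \<open>Convolutions and generating function values\<close>

definition conv :: "(nat \<Rightarrow> real) \<Rightarrow> (nat \<Rightarrow> real) \<Rightarrow> nat \<Rightarrow> real" where
  "conv a b n = (\<Sum>i\<le>n. a i * b (n - i))"

text \<open>Multiplication of the generating function by x: the root connective adds one to the
  complexity.\<close>

definition shift :: "(nat \<Rightarrow> real) \<Rightarrow> nat \<Rightarrow> real" where
  "shift a n = (case n of 0 \<Rightarrow> 0 | Suc m \<Rightarrow> a m)"

lemma shift_simps [simp]: "shift a 0 = 0" "shift a (Suc n) = a n"
  by (simp_all add: shift_def)

text \<open>The last \<open>K\<close> terms are reversed, so that both outer blocks pair a short
  initial segment of one sequence with the far tail of the other. The hypothesis keeps the blocks
  disjoint.\<close>

lemma conv_split:
  assumes "2 * K \<le> n"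
  shows "conv a b n = (\<Sum>i<K. a i * b (n - i)) + (\<Sum>i<K. b i * a (n - i)) + (\<Sum>i\<in>{K..n-K}. a i * b (n - i))"
proof -
  have "(\<Sum>i\<in>{n-K<..n}. a i * b (n - i)) = (\<Sum>i<K. b i * a (n - i))"
    by (rule sum.reindex_bij_witness[of _ "\<lambda>i. n - i" "\<lambda>i. n - i"]) (use assms in auto)
  moreover have "{..n} = {..<K} \<union> {K..n-K} \<union> {n-K<..n}" using assms by auto
  moreover have "(\<Sum>i\<in>{..<K} \<union> {K..n-K} \<union> {n-K<..n}. a i * b (n - i)) =
     (\<Sum>i<K. a i * b (n - i)) + (\<Sum>i\<in>{K..n-K}. a i * b (n - i)) + (\<Sum>i\<in>{n-K<..n}. a i * b (n - i))"
    using assms by (subst sum.union_disjoint; (subst sum.union_disjoint)?) auto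
  ultimately show ?thesis unfolding conv_def by simp
qed

text \<open>The condition on \<open>conv f f\<close> makes \<open>f n * \<rho> ^ n\<close> subexponential: in a product of
  two large formulas almost all of the size sits in one factor.\<close>

locale subexp =
  fixes f :: "nat \<Rightarrow> real" and \<rho> :: real
  assumes f_pos: "f n > 0" and rho_pos: "\<rho> > 0"
    and ratio: "(\<lambda>n. f n / f (Suc n)) \<longlonglongrightarrow> \<rho>"
    and summable_f: "summable (\<lambda>n. f n * \<rho> ^ n)"
    and conv_self: "(\<lambda>n. conv f f n / f n) \<longlonglongrightarrow> 2 * (\<Sum>n. f n * \<rho> ^ n)"
begin

definition gf :: "(nat \<Rightarrow> real) \<Rightarrow> real" where "gf a = (\<Sum>n. a n * \<rho> ^ n)"

definition dominated :: "(nat \<Rightarrow> real) \<Rightarrow> bool" where "dominated a \<longleftrightarrow> (\<forall>n. 0 \<le> a n \<and> a n \<le> f n)"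

definition close :: "(nat \<Rightarrow> real) \<Rightarrow> real \<Rightarrow> real \<Rightarrow> bool" where
  "close a \<alpha> e \<longleftrightarrow> near (\<lambda>n. a n / f n) \<alpha> e"

lemma f_nonzero [simp]: "f n \<noteq> 0" using f_pos[of n] by simp

lemma dominated_summable:
  assumes "dominated a" shows "summable (\<lambda>n. a n * \<rho> ^ n)"
  by (rule summable_comparison_test'[OF summable_f, of 0])
    (use assms rho_pos in \<open>auto simp: dominated_def abs_mult intro!: mult_right_mono\<close>)

lemma gf_nonneg: assumes "dominated a" shows "0 \<le> gf a"
  unfolding gf_def using assms rho_pos
  by (intro suminf_nonneg dominated_summable) (auto simp: dominated_def)

lemma gf_le: assumes "dominated a" shows "gf a \<le> gf f"
  unfolding gf_def using assms rho_pos
  by (intro suminf_le dominated_summable summable_f) (auto simp: dominated_def)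

lemma gf_add:
  assumes "summable (\<lambda>n. a n * \<rho> ^ n)" "summable (\<lambda>n. b n * \<rho> ^ n)"
  shows "gf (\<lambda>n. a n + b n) = gf a + gf b"
  unfolding gf_def by (subst suminf_add[OF assms]) (simp add: distrib_right)

lemma
  assumes "summable (\<lambda>n. a n * \<rho> ^ n)"
  shows summable_shift: "summable (\<lambda>n. shift a n * \<rho> ^ n)"
    and gf_shift: "gf (shift a) = \<rho> * gf a"
proof -
  have "(\<lambda>n. shift a (Suc n) * \<rho> ^ Suc n) sums (\<rho> * gf a)"
    using sums_mult[OF summable_sums[OF assms], of \<rho>] unfolding gf_def by (simp add: ac_simps)
  then have "(\<lambda>n. shift a n * \<rho> ^ n) sums (\<rho> * gf a)"
    using sums_Suc_iff[of "\<lambda>n. shift a n * \<rho> ^ n"] by simp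
  then show "summable (\<lambda>n. shift a n * \<rho> ^ n)" "gf (shift a) = \<rho> * gf a"
    unfolding gf_def by (auto simp: sums_iff)
qed

lemma
  assumes "dominated a" "dominated b"
  shows summable_conv: "summable (\<lambda>n. conv a b n * \<rho> ^ n)"
    and gf_conv: "gf (conv a b) = gf a * gf b"
proof -
  have n: "summable (\<lambda>n. norm (a n * \<rho> ^ n))" "summable (\<lambda>n. norm (b n * \<rho> ^ n))"
    using dominated_summable[OF assms(1)] dominated_summable[OF assms(2)] assms rho_pos
    by (auto simp: dominated_def abs_mult)
  have "(\<lambda>k. \<Sum>i\<le>k. a i * \<rho> ^ i * (b (k - i) * \<rho> ^ (k - i))) sums (gf a * gf b)"
    using Cauchy_product_sums[OF n] by (simp add: gf_def)
  moreover have "(\<Sum>i\<le>k. a i * \<rho> ^ i * (b (k - i) * \<rho> ^ (k - i))) = conv a b k * \<rho> ^ k" for k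
    unfolding conv_def sum_distrib_right
    by (rule sum.cong) (auto simp: power_add[symmetric] ac_simps)
  ultimately have "(\<lambda>n. conv a b n * \<rho> ^ n) sums (gf a * gf b)" by simp
  then show "summable (\<lambda>n. conv a b n * \<rho> ^ n)" "gf (conv a b) = gf a * gf b"
    unfolding gf_def by (auto simp: sums_iff)
qed

text \<open>A product of \<open>k\<close> consecutive ratios; truncated subtraction affects only
  finitely many \<open>n\<close>.\<close>

lemma ratio_power: "(\<lambda>n. f (n - k) / f n) \<longlonglongrightarrow> \<rho> ^ k"
proof (induction k)
  case (Suc k)
  have "(\<lambda>n. f n / f (Suc n) * (f (Suc n - Suc (k)) / f n)) \<longlonglongrightarrow> \<rho> * \<rho> ^ k"
    using tendsto_mult[OF ratio Suc] by simp
  then have "(\<lambda>n. f (Suc n - Suc k) / f (Suc n)) \<longlonglongrightarrow> \<rho> ^ Suc k" by simp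
  then show ?case by (rule LIMSEQ_imp_Suc)
qed simp

lemma conv_head_tendsto: "(\<lambda>n. (\<Sum>i<K. a i * f (n - i)) / f n) \<longlonglongrightarrow> (\<Sum>i<K. a i * \<rho> ^ i)"
proof -
  have "(\<lambda>n. \<Sum>i<K. a i * (f (n - i) / f n)) \<longlonglongrightarrow> (\<Sum>i<K. a i * \<rho> ^ i)"
    by (intro tendsto_intros ratio_power)
  then show ?thesis by (simp add: sum_divide_distrib)
qed

lemma partial_gf_eventually:
  assumes "dominated a" "\<epsilon> > 0"
  shows "\<forall>\<^sub>F K in sequentially. \<bar>(\<Sum>i<K. a i * \<rho> ^ i) - gf a\<bar> < \<epsilon>"
  using tendstoD[OF summable_LIMSEQ[OF dominated_summable[OF assms(1)]] assms(2)]
  by (simp add: gf_def dist_real_def)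

lemma dominated_f: "dominated f"
  using f_pos by (auto simp: dominated_def less_imp_le)

text \<open>The whole convolution quotient tends to \<open>2 * gf f\<close>, and each of the two
  outer blocks to a partial sum of \<open>gf f\<close>. For large \<open>K\<close> these almost
  exhaust the total, so little is left for the middle.\<close>

lemma conv_middle_small:
  assumes "\<epsilon> > 0"
  shows "\<forall>\<^sub>F K in sequentially. \<forall>\<^sub>F n in sequentially. (\<Sum>i\<in>{K..n-K}. f i * f (n - i)) / f n \<le> \<epsilon>"
proof -
  have "\<epsilon>/4 > 0" using assms by simp
  from partial_gf_eventually[OF dominated_f this] show ?thesis
  proof eventually_elim
    case (elim K)
    let ?h = "\<lambda>n. \<Sum>i<K. f i * f (n - i)"
    have "(\<lambda>n. conv f f n / f n - 2 * (?h n / f n)) \<longlonglongrightarrow> 2 * gf f - 2 * (\<Sum>i<K. f i * \<rho> ^ i)"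
      using conv_self unfolding gf_def by (intro tendsto_intros conv_head_tendsto)
    moreover have "2 * gf f - 2 * (\<Sum>i<K. f i * \<rho> ^ i) < \<epsilon>" using elim assms by linarith
    ultimately have "\<forall>\<^sub>F n in sequentially. conv f f n / f n - 2 * (?h n / f n) < \<epsilon>"
      by (rule order_tendstoD)
    moreover have "\<forall>\<^sub>F n in sequentially. 2 * K \<le> n" by (rule eventually_ge_at_top)
    ultimately show ?case
    proof eventually_elim
      case (elim n)
      then show ?case using conv_split[of K n f f] by (simp add: add_divide_distrib)
    qed
  qed
qed

lemma conv_head_near:
  assumes a: "dominated a" and b: "close b \<beta> e" and e: "0 \<le> e" and \<epsilon>: "\<epsilon> > 0"
  shows "\<forall>\<^sub>F K in sequentially. \<forall>\<^sub>F n in sequentially.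
    \<bar>(\<Sum>i<K. a i * b (n - i)) / f n - \<beta> * gf a\<bar> \<le> gf a * e + \<epsilon>"
proof -
  \<comment> \<open>Again the sum of the coefficients of \<open>\<delta>\<close> in the final
    estimate, with \<open>\<delta> * \<delta> \<le> \<delta>\<close>.\<close>
  define D where "D = 2 * e + gf a + 2 + 2 * \<bar>\<beta>\<bar>"
  have A: "0 \<le> gf a" by (rule gf_nonneg[OF a])
  have D: "D > 0" using e A unfolding D_def by simp
  define \<delta> where "\<delta> = min 1 (\<epsilon> / D)"
  have \<delta>: "\<delta> > 0" "\<delta> \<le> 1" "\<delta> * D \<le> \<epsilon>"
    using D \<open>\<epsilon> > 0\<close> by (auto simp: \<delta>_def min_def field_simps)
  have an: "0 \<le> a i" for i using a by (auto simp: dominated_def)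
  from partial_gf_eventually[OF a \<delta>(1)] show ?thesis
  proof eventually_elim
    case (elim K)
    let ?H = "\<lambda>n. \<Sum>i<K. a i * f (n - i)"
    have "\<forall>\<^sub>F n in sequentially. \<bar>?H n / f n - (\<Sum>i<K. a i * \<rho> ^ i)\<bar> < \<delta>"
      using tendstoD[OF conv_head_tendsto[of a K] \<delta>(1)] by (simp add: dist_real_def)
    \<comment> \<open>Only the offsets \<open>i < K\<close> occur, so one threshold, moved by
      \<open>K\<close>, serves all of them.\<close>
    moreover have "\<forall>\<^sub>F n in sequentially. \<forall>i<K. \<bar>b (n - i) / f (n - i) - \<beta>\<bar> \<le> e + \<delta>"
    proof -
      obtain N where N: "\<bar>b n / f n - \<beta>\<bar> \<le> e + \<delta>" if "n \<ge> N" for n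
        using b \<delta>(1) unfolding close_def near_def eventually_sequentially by blast
      show ?thesis unfolding eventually_sequentially
        by (rule exI[of _ "N + K"]) (auto intro!: N)
    qed
    ultimately show ?case
    proof eventually_elim
      case (elim n)
      have H: "\<bar>?H n / f n - gf a\<bar> \<le> 2 * \<delta>"
        using elim \<open>\<bar>(\<Sum>i<K. a i * \<rho> ^ i) - gf a\<bar> < \<delta>\<close> by linarith
      have "\<bar>(\<Sum>i<K. a i * b (n - i)) - \<beta> * ?H n\<bar> = \<bar>\<Sum>i<K. a i * (b (n - i) - \<beta> * f (n - i))\<bar>"
        by (simp add: sum_distrib_left sum_subtractf algebra_simps)
      also have "\<dots> \<le> (\<Sum>i<K. a i * ((e + \<delta>) * f (n - i)))"
      proof (intro order_trans[OF sum_abs] sum_mono)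
        fix i assume "i \<in> {..<K}"
        then have "\<bar>b (n - i) / f (n - i) - \<beta>\<bar> * f (n - i) \<le> (e + \<delta>) * f (n - i)"
          using elim f_pos[of "n - i"] by (intro mult_right_mono) auto
        also have "\<bar>b (n - i) / f (n - i) - \<beta>\<bar> * f (n - i) = \<bar>(b (n - i) / f (n - i) - \<beta>) * f (n - i)\<bar>"
          using f_pos[of "n - i"] by (simp add: abs_mult)
        also have "(b (n - i) / f (n - i) - \<beta>) * f (n - i) = b (n - i) - \<beta> * f (n - i)"
          by (simp add: left_diff_distrib)
        finally show "\<bar>a i * (b (n - i) - \<beta> * f (n - i))\<bar> \<le> a i * ((e + \<delta>) * f (n - i))"
          using an[of i] by (simp add: abs_mult mult_left_mono)
      qed
      also have "\<dots> = (e + \<delta>) * ?H n" by (simp add: sum_distrib_left ac_simps)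
      finally have "\<bar>(\<Sum>i<K. a i * b (n - i)) - \<beta> * ?H n\<bar> / f n \<le> (e + \<delta>) * ?H n / f n"
        using f_pos[of n] by (simp add: divide_right_mono)
      moreover have "\<bar>(\<Sum>i<K. a i * b (n - i)) - \<beta> * ?H n\<bar> / f n = \<bar>(\<Sum>i<K. a i * b (n - i)) / f n - \<beta> * (?H n / f n)\<bar>"
        using f_pos[of n] by (simp add: diff_divide_distrib[symmetric])
      ultimately have 1: "\<bar>(\<Sum>i<K. a i * b (n - i)) / f n - \<beta> * (?H n / f n)\<bar> \<le> (e + \<delta>) * (?H n / f n)" by simp
      have 2: "(e + \<delta>) * (?H n / f n) \<le> (e + \<delta>) * (gf a + 2 * \<delta>)"
        using H e \<delta> by (intro mult_left_mono) auto
      have "\<bar>\<beta> * (?H n / f n) - \<beta> * gf a\<bar> = \<bar>\<beta>\<bar> * \<bar>?H n / f n - gf a\<bar>"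
        by (simp only: right_diff_distrib[symmetric] abs_mult)
      also have "\<dots> \<le> \<bar>\<beta>\<bar> * (2 * \<delta>)" using H by (intro mult_left_mono) auto
      finally have 3: "\<bar>\<beta> * (?H n / f n) - \<beta> * gf a\<bar> \<le> \<bar>\<beta>\<bar> * (2 * \<delta>)" .
      have "(e + \<delta>) * (gf a + 2 * \<delta>) + \<bar>\<beta>\<bar> * (2 * \<delta>) = gf a * e + (2 * e * \<delta> + \<delta> * gf a + 2 * (\<delta> * \<delta>) + 2 * \<bar>\<beta>\<bar> * \<delta>)"
        by (simp add: algebra_simps)
      also have "\<dots> \<le> gf a * e + \<delta> * D"
      proof -
        have "\<delta> * \<delta> \<le> \<delta> * 1" using \<delta> by (intro mult_left_mono) auto
        then show ?thesis unfolding D_def by (simp add: algebra_simps)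
      qed
      finally show ?case using 1 2 3 \<delta>(3) by linarith
    qed
  qed
qed

text \<open>In a large product one factor is small. Summing over the small factor gives its
  generating function value, and the large factor contributes its density; the middle block is
  dominated by that of \<open>conv f f\<close>. The errors obey the same product rule as the
  densities, which is the source of the contraction factors for recursive classes.\<close>

lemma close_conv:
  assumes a: "dominated a" "close a \<alpha> d" "0 \<le> d" and b: "dominated b" "close b \<beta> e" "0 \<le> e"
  shows "close (conv a b) (\<alpha> * gf b + \<beta> * gf a) (gf b * d + gf a * e)"
  unfolding close_def near_def
proof (intro allI impI)
  fix \<epsilon> :: real assume "\<epsilon> > 0"
  then have \<epsilon>: "\<epsilon>/3 > 0" by simp
  have "\<forall>\<^sub>F K in sequentially.
      (\<forall>\<^sub>F n in sequentially. \<bar>(\<Sum>i<K. a i * b (n - i)) / f n - \<beta> * gf a\<bar> \<le> gf a * e + \<epsilon>/3) \<and>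
      (\<forall>\<^sub>F n in sequentially. \<bar>(\<Sum>i<K. b i * a (n - i)) / f n - \<alpha> * gf b\<bar> \<le> gf b * d + \<epsilon>/3) \<and>
      (\<forall>\<^sub>F n in sequentially. (\<Sum>i\<in>{K..n-K}. f i * f (n - i)) / f n \<le> \<epsilon>/3)"
    by (intro eventually_conj conv_head_near conv_middle_small a b \<epsilon>)
  from eventually_happens'[OF sequentially_bot this] obtain K where
      "\<forall>\<^sub>F n in sequentially. \<bar>(\<Sum>i<K. a i * b (n - i)) / f n - \<beta> * gf a\<bar> \<le> gf a * e + \<epsilon>/3"
      "\<forall>\<^sub>F n in sequentially. \<bar>(\<Sum>i<K. b i * a (n - i)) / f n - \<alpha> * gf b\<bar> \<le> gf b * d + \<epsilon>/3"
      "\<forall>\<^sub>F n in sequentially. (\<Sum>i\<in>{K..n-K}. f i * f (n - i)) / f n \<le> \<epsilon>/3"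
    by blast
  moreover have "\<forall>\<^sub>F n in sequentially. 2 * K \<le> n" by (rule eventually_ge_at_top)
  ultimately show "\<forall>\<^sub>F n in sequentially. \<bar>conv a b n / f n - (\<alpha> * gf b + \<beta> * gf a)\<bar> \<le> gf b * d + gf a * e + \<epsilon>"
  proof eventually_elim
    case (elim n)
    let ?m = "(\<Sum>i\<in>{K..n-K}. a i * b (n - i)) / f n"
    have "0 \<le> ?m" using a(1) b(1) f_pos[of n]
      by (intro divide_nonneg_pos sum_nonneg) (auto simp: dominated_def)
    moreover have "?m \<le> (\<Sum>i\<in>{K..n-K}. f i * f (n - i)) / f n"
      using a(1) b(1) f_pos[of n] less_imp_le[OF f_pos]
      by (intro divide_right_mono sum_mono mult_mono) (auto simp: dominated_def)
    ultimately have m: "\<bar>?m\<bar> \<le> \<epsilon>/3" using elim by linarith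
    have "conv a b n / f n = (\<Sum>i<K. a i * b (n - i)) / f n + (\<Sum>i<K. b i * a (n - i)) / f n + ?m"
      using conv_split[of K n a b] elim by (simp add: add_divide_distrib)
    then show ?case using elim m by linarith
  qed
qed

lemma close_add: "close a \<alpha> d \<Longrightarrow> close b \<beta> e \<Longrightarrow> close (\<lambda>n. a n + b n) (\<alpha> + \<beta>) (d + e)"
  unfolding close_def by (simp add: add_divide_distrib near_add)

lemma close_minus: "close a \<alpha> e \<Longrightarrow> close (\<lambda>n. - a n) (- \<alpha>) e"
  unfolding close_def by (drule near_minus) simp

lemma close_shift:
  assumes "close a \<alpha> e" "0 \<le> e" shows "close (shift a) (\<rho> * \<alpha>) (\<rho> * e)"
proof -
  have "near (\<lambda>n. shift a (Suc n) / f (Suc n)) (\<alpha> * \<rho>) (e * \<bar>\<rho>\<bar>)"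
    using near_mult_tendsto[OF assms(1)[unfolded close_def] ratio assms(2)] by simp
  then show ?thesis
    unfolding close_def near_def
    using eventually_sequentially_Suc[of "\<lambda>n. \<bar>shift a n / f n - \<rho> * \<alpha>\<bar> \<le> \<rho> * e + _"] rho_pos
    by (simp add: mult.commute)
qed

text \<open>Domination puts \<open>a n / f n\<close> between 0 and 1, which supplies the initial
  error.\<close>

lemma close_contraction:
  assumes "dominated a" "0 \<le> c" "c < 1"
    and "\<And>e. 0 \<le> e \<Longrightarrow> close a \<alpha> e \<Longrightarrow> close a \<alpha> (c * e)"
  shows "close a \<alpha> 0"
proof -
  have "\<bar>a n / f n - \<alpha>\<bar> \<le> 1 + \<bar>\<alpha>\<bar>" for n
  proof -
    have "0 \<le> a n / f n" "a n / f n \<le> 1" using assms(1) f_pos[of n] by (auto simp: dominated_def)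
    then show ?thesis by linarith
  qed
  then have "close a \<alpha> (1 + \<bar>\<alpha>\<bar>)" unfolding close_def near_def
    by (intro allI impI always_eventually) (meson less_eq_real_def add_increasing2 order_trans)
  then show ?thesis
    using near_contraction[of c "1 + \<bar>\<alpha>\<bar>" "\<lambda>n. a n / f n" \<alpha>] assms
    unfolding close_def near_zero_iff by auto
qed

end

section \<open>Counting trees\<close>

text \<open>Trees with \<open>t\<close> kinds of leaves, \<open>s\<close> unary and two binary
  connectives. The condition \<open>\<rho> < 1\<close> selects the smaller zero of the discriminant
  when \<open>s > 0\<close>: at 1 the discriminant is negative.\<close>

locale tree_count =
  fixes f :: "nat \<Rightarrow> real" and s t \<rho> :: real
  assumes f_0: "f 0 = t" and f_Suc: "f (Suc n) = s * f n + 2 * conv f f n"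
    and s: "0 \<le> s" "s \<le> 1" and t: "1 \<le> t"
    and radius: "0 < \<rho>" "\<rho> < 1" and discriminant_eq: "(1 - s * \<rho>)\<^sup>2 = 8 * t * \<rho>"
begin

lemma positive: "f n > 0"
proof (induction n rule: less_induct)
  case (less n)
  show ?case
  proof (cases n)
    case (Suc m)
    have "0 < conv f f m" unfolding conv_def
      using less Suc by (intro sum_pos mult_pos_pos) auto
    moreover have "0 \<le> s * f m" using less Suc s by (simp add: less_imp_le)
    ultimately show ?thesis using Suc f_Suc by simp
  qed (use f_0 t in simp)
qed

text \<open>The convolution term with a leaf on the left already doubles the count. The bound
  \<open>f n / f (Suc n) \<le> 1/2\<close> is later the contraction constant for the ratios.\<close>

lemma f_growth: "2 * f n \<le> f (Suc n)"
proof -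
  have "f 0 * f n \<le> conv f f n"
    unfolding conv_def using sum_nonneg_leq_bound[of "{..n}" "\<lambda>i. f i * f (n - i)" _ 0]
      less_imp_le[OF positive] member_le_sum[of 0 "{..n}" "\<lambda>i. f i * f (n - i)"] by simp
  moreover have "f n \<le> f 0 * f n" using f_0 t positive[of n] by simp
  moreover have "0 \<le> s * f n" using s positive[of n] by simp
  ultimately show ?thesis using f_Suc[of n] by linarith
qed

section \<open>The generating function at its radius of convergence\<close>

definition \<tau> :: real where "\<tau> = (1 - s * \<rho>) / (4 * \<rho>)"

text \<open>\<open>\<tau>\<close> is the double root of this quadratic, since \<rho> annihilates the
  discriminant.\<close>

lemma tau_eq: "t + s * \<rho> * \<tau> + 2 * \<rho> * \<tau>\<^sup>2 = \<tau>"
proof -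
  have "8 * \<rho> * (t + s * \<rho> * \<tau> + 2 * \<rho> * \<tau>\<^sup>2 - \<tau>) = 8 * t * \<rho> - (1 - s * \<rho>)\<^sup>2"
    unfolding \<tau>_def using radius by (simp add: field_simps power2_eq_square)
  then show ?thesis using discriminant_eq radius by simp
qed

lemma s_rho: "0 \<le> s * \<rho>" "s * \<rho> < 1"
proof -
  show "0 \<le> s * \<rho>" using s radius by simp
  have "s * \<rho> \<le> 1 * \<rho>" using s radius by (intro mult_right_mono) auto
  then show "s * \<rho> < 1" using radius by linarith
qed

lemma tau_pos: "\<tau> > 0" unfolding \<tau>_def using s_rho radius by simp

text \<open>The index pairs with \<open>i + j < K\<close> form a triangle inside the square
  \<open>i, j < K\<close>.\<close>

lemma conv_partial_sum:
  assumes "\<And>i. 0 \<le> a i"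
  shows "(\<Sum>n<K. conv a a n) \<le> (\<Sum>i<K. a i)\<^sup>2"
proof -
  have "(\<Sum>n<K. conv a a n) = (\<Sum>(n, i)\<in>Sigma {..<K} (\<lambda>n. {..n}). a i * a (n - i))"
    unfolding conv_def by (subst sum.Sigma) auto
  also have "\<dots> = (\<Sum>(i, j)\<in>{(i, j). i + j < K}. a i * a j)"
    by (rule sum.reindex_bij_witness[of _ "\<lambda>(i, j). (i + j, i)" "\<lambda>(n, i). (i, n - i)"]) auto
  also have "\<dots> \<le> (\<Sum>(i, j)\<in>{..<K} \<times> {..<K}. a i * a j)"
    using assms by (intro sum_mono2) auto
  also have "\<dots> = (\<Sum>i<K. a i)\<^sup>2"
    by (simp add: power2_eq_square sum_product sum.cartesian_product)
  finally show ?thesis .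
qed

text \<open>The right-hand side of the quadratic equation is monotone on nonnegative numbers and
  fixes \<open>\<tau>\<close>; each partial sum is at most its value at the preceding one, so none
  can pass \<open>\<tau>\<close>.\<close>

lemma partial_sum_le: "(\<Sum>i<K. f i * \<rho> ^ i) \<le> \<tau>"
proof (induction K)
  case (Suc K)
  let ?a = "\<lambda>i. f i * \<rho> ^ i"
  let ?S = "\<Sum>i<K. ?a i"
  have a: "0 \<le> ?a i" for i using positive[of i] radius by simp
  have S: "0 \<le> ?S" by (rule sum_nonneg) (use a in simp)
  have "conv ?a ?a n = conv f f n * \<rho> ^ n" for n
    unfolding conv_def sum_distrib_right
    by (rule sum.cong) (auto simp: power_add[symmetric] ac_simps)
  then have "?a (Suc n) = s * \<rho> * ?a n + 2 * \<rho> * conv ?a ?a n" for n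
    by (simp add: f_Suc algebra_simps)
  then have "(\<Sum>i<Suc K. ?a i) = t + s * \<rho> * ?S + 2 * \<rho> * (\<Sum>n<K. conv ?a ?a n)"
    unfolding sum.lessThan_Suc_shift by (simp add: f_0 sum.distrib sum_distrib_left)
  also have "\<dots> \<le> t + s * \<rho> * \<tau> + 2 * \<rho> * \<tau>\<^sup>2"
  proof -
    have "(\<Sum>n<K. conv ?a ?a n) \<le> ?S\<^sup>2" by (rule conv_partial_sum) (rule a)
    also have "\<dots> \<le> \<tau>\<^sup>2" using Suc S by (intro power_mono)
    finally have "2 * \<rho> * (\<Sum>n<K. conv ?a ?a n) \<le> 2 * \<rho> * \<tau>\<^sup>2"
      using radius by (intro mult_left_mono) auto
    moreover have "s * \<rho> * ?S \<le> s * \<rho> * \<tau>" using Suc s_rho by (intro mult_left_mono) auto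
    ultimately show ?thesis by linarith
  qed
  finally show ?case using tau_eq by simp
qed (use tau_pos in simp)

lemma summable_at_rho: "summable (\<lambda>n. f n * \<rho> ^ n)"
proof (rule summableI_nonneg_bounded)
  show "0 \<le> f n * \<rho> ^ n" for n using positive[of n] radius by simp
qed (rule partial_sum_le)

lemma gf_f: "(\<Sum>n. f n * \<rho> ^ n) = \<tau>"
proof -
  let ?a = "\<lambda>n. f n * \<rho> ^ n"
  let ?S = "\<Sum>n. ?a n"
  have n: "summable (\<lambda>n. norm (?a n))"
    using summable_at_rho less_imp_le[OF positive] radius by (simp add: abs_mult)
  have c: "(\<lambda>k. \<Sum>i\<le>k. ?a i * ?a (k - i)) sums (?S * ?S)"
    using Cauchy_product_sums[OF n n] .
  have "(\<Sum>i\<le>k. ?a i * ?a (k - i)) = conv f f k * \<rho> ^ k" for k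
    unfolding conv_def sum_distrib_right
    by (rule sum.cong) (auto simp: power_add[symmetric] ac_simps)
  with c have c': "(\<lambda>k. conv f f k * \<rho> ^ k) sums (?S * ?S)" by simp
  have "(\<lambda>k. s * \<rho> * ?a k + 2 * \<rho> * (conv f f k * \<rho> ^ k)) sums (s * \<rho> * ?S + 2 * \<rho> * (?S * ?S))"
    by (intro sums_add sums_mult summable_sums summable_at_rho c')
  moreover have "s * \<rho> * ?a k + 2 * \<rho> * (conv f f k * \<rho> ^ k) = ?a (Suc k)" for k
    by (simp add: f_Suc algebra_simps)
  ultimately have "(\<lambda>k. ?a (Suc k)) sums (s * \<rho> * ?S + 2 * \<rho> * (?S * ?S))" by simp
  then have "?a sums (s * \<rho> * ?S + 2 * \<rho> * (?S * ?S) + ?a 0)" by (rule sums_Suc)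
  then have "?S = s * \<rho> * ?S + 2 * \<rho> * (?S * ?S) + t" using f_0 by (simp add: sums_iff)
  \<comment> \<open>Completing the square; with zero discriminant the root is unique, so no choice
    of branch arises.\<close>
  then have "(4 * \<rho> * ?S - (1 - s * \<rho>))\<^sup>2 = (1 - s * \<rho>)\<^sup>2 - 8 * t * \<rho>" by algebra
  then have "4 * \<rho> * ?S = 1 - s * \<rho>" using discriminant_eq by simp
  then show ?thesis unfolding \<tau>_def using radius by (simp add: field_simps)
qed

text \<open>With \<open>Y = 1 - s X - 4 X F\<close> the equation \<open>F = t + s X F + 2 X F\<^sup>2\<close> says that \<open>Y\<^sup>2\<close> is a
  quadratic polynomial \<open>\<Delta>\<close>; the recurrence is the coefficient form of \<open>2 Y' \<Delta> = \<Delta>' Y\<close>.\<close>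

lemma f_recurrence:
  includes fps_syntax
  shows "(n + 3) * f (n + 2) = (2 * s + 8 * t) * (n + 3/2) * f (n + 1) - s\<^sup>2 * n * f n"
proof -
  define F where "F = Abs_fps f"
  define C where "C = (fps_const :: real \<Rightarrow> real fps)"
  define Y where "Y = 1 - C s * fps_X - 4 * fps_X * F"
  define \<Delta> where "\<Delta> = 1 - C (2 * s + 8 * t) * fps_X + C (s\<^sup>2) * fps_X\<^sup>2"
  have F: "F = C t + C s * fps_X * F + 2 * fps_X * F\<^sup>2"
  proof (rule fps_ext)
    fix n
    have two: "(2 :: real fps) = C 2" unfolding C_def by (simp add: numeral_fps_const)
    show "F $ n = (C t + C s * fps_X * F + 2 * fps_X * F\<^sup>2) $ n"
      unfolding two power2_eq_square C_def F_def
      by (cases n) (simp_all add: f_0 f_Suc conv_def mult.assoc fps_mult_nth[of "Abs_fps f" "Abs_fps f"] atLeast0AtMost)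
  qed
  have Cb: "C (2 * s + 8 * t) = 2 * C s + 8 * C t" "C (s\<^sup>2) = (C s)\<^sup>2"
    unfolding C_def by (simp_all add: fps_const_add[symmetric] fps_const_mult[symmetric] numeral_fps_const power2_eq_square del: fps_const_add fps_const_mult)
  have YY: "Y * Y = \<Delta>" unfolding Y_def \<Delta>_def Cb using F by algebra
  \<comment> \<open>Differentiating \<open>Y * Y\<close> and multiplying by \<open>Y\<close> removes
    the square root and leaves a linear equation for \<open>Y\<close>.\<close>
  have "2 * fps_deriv Y * \<Delta> = fps_deriv (Y * Y) * Y"
    unfolding YY[symmetric] by (simp add: algebra_simps)
  then have "2 * fps_deriv Y * \<Delta> = fps_deriv \<Delta> * Y" unfolding YY .
  then have coeff: "(2 * fps_deriv Y * \<Delta>) $ (n + 2) = (fps_deriv \<Delta> * Y) $ (n + 2)" by simp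
  have lhs: "(2 * fps_deriv Y * \<Delta>) $ (n + 2) =
      2 * ((n + 3) * Y $ (n + 3) - (2 * s + 8 * t) * (n + 2) * Y $ (n + 2) + s\<^sup>2 * (n + 1) * Y $ (n + 1))"
  proof -
    have e: "2 * fps_deriv Y * \<Delta> = C 2 * (fps_deriv Y - C (2 * s + 8 * t) * (fps_X * fps_deriv Y) + C (s\<^sup>2) * (fps_X * (fps_X * fps_deriv Y)))"
      unfolding \<Delta>_def C_def by (simp add: algebra_simps numeral_fps_const power2_eq_square)
    show ?thesis unfolding e unfolding C_def by (simp add: numeral_eq_Suc algebra_simps)
  qed
  have rhs: "(fps_deriv \<Delta> * Y) $ (n + 2) = - (2 * s + 8 * t) * Y $ (n + 2) + 2 * s\<^sup>2 * Y $ (n + 1)"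
  proof -
    have "fps_deriv \<Delta> = - C (2 * s + 8 * t) + C (2 * s\<^sup>2) * fps_X"
      unfolding \<Delta>_def C_def by (simp add: power2_eq_square numeral_fps_const[symmetric] fps_const_mult[symmetric] del: fps_const_mult)
    then have e: "fps_deriv \<Delta> * Y = - (C (2 * s + 8 * t) * Y) + C (2 * s\<^sup>2) * (fps_X * Y)" by algebra
    show ?thesis unfolding e unfolding C_def by (simp add: numeral_eq_Suc algebra_simps)
  qed
  have Y: "Y $ (k + 2) = - 4 * f (k + 1)" for k
  proof -
    have "Y = 1 - C s * fps_X - C 4 * (fps_X * F)"
      unfolding Y_def C_def by (simp add: numeral_fps_const mult.assoc)
    then show ?thesis unfolding C_def F_def by (simp add: numeral_eq_Suc)
  qed
  have Y3: "Y $ (n + 3) = - 4 * f (n + 2)" using Y[of "n + 1"] by (simp add: numeral_eq_Suc)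
  \<comment> \<open>The coefficient of \<open>Y\<close> at index 1 also contains \<open>- s\<close>,
    so the formula for \<open>Y\<close> fails there; the factor \<open>n\<close> makes this case
    vanish.\<close>
  have Y1: "n * Y $ (n + 1) = n * (- 4 * f n)"
    using Y[of "n - 1"] by (cases n) (simp_all add: numeral_eq_Suc)
  have "2 * s\<^sup>2 * (n * Y $ (n + 1)) = 8 * (n + 3) * f (n + 2) - 8 * (2 * s + 8 * t) * (n + 3/2) * f (n + 1)"
    using coeff unfolding lhs rhs Y Y3 by (simp add: algebra_simps)
  then show ?thesis unfolding Y1 by (simp add: algebra_simps)
qed

text \<open>Divided by \<open>f (n + 1)\<close>, the linear recurrence says that
  \<open>1 / q (Suc n)\<close> is \<open>2 s + 8 t - s^2 q n\<close> up to O(1/n), while the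
  discriminant equation says that \<rho> is a fixed point of the limiting map. Subtracting
  reciprocals produces the factor \<open>q (Suc n) * \<rho>\<close>, at most 1/2, so deviations from
  \<rho> are halved up to a vanishing error.\<close>

lemma ratio_tendsto: "(\<lambda>n. f n / f (Suc n)) \<longlonglongrightarrow> \<rho>"
proof -
  define q where "q = (\<lambda>n. f n / f (Suc n))"
  define d where "d = (\<lambda>n::nat. (3 * (2 * s + 8 * t) + 3) / (n + 3))"
  have q: "0 < q n" "q n \<le> 1/2" for n
    using f_growth[of n] positive[of n] positive[of "Suc n"] unfolding q_def by (auto simp: field_simps)
  have inv: "1 / \<rho> = 2 * s + 8 * t - s\<^sup>2 * \<rho>"
    using discriminant_eq radius by (simp add: field_simps power2_eq_square)
  have step: "\<bar>q (Suc n) - \<rho>\<bar> \<le> 1/2 * \<bar>q n - \<rho>\<bar> + d n" for n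
  proof -
    have p: "f (Suc n) > 0" "f (Suc (Suc n)) > 0" "f n > 0" by (rule positive)+
    have "(n + 3) / q (Suc n) = (2 * s + 8 * t) * (n + 3/2) - s\<^sup>2 * n * q n"
    proof -
      have "(n + 3) / q (Suc n) = (n + 3) * f (n + 2) / f (n + 1)" unfolding q_def by simp
      also have "\<dots> = (2 * s + 8 * t) * (n + 3/2) - s\<^sup>2 * n * q n"
        using f_recurrence[of n] p unfolding q_def by (simp add: diff_divide_distrib)
      finally show ?thesis .
    qed
    then have *: "1 / q (Suc n) = ((2 * s + 8 * t) * (n + 3/2) - s\<^sup>2 * n * q n) / (n + 3)"
      by (simp add: field_simps)
    \<comment> \<open>The remainder from writing \<open>n + 3/2\<close> and \<open>n\<close> as
      \<open>n + 3\<close> minus a constant.\<close>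
    define \<delta> where "\<delta> = (3 * (s\<^sup>2 * q n) - (2 * s + 8 * t) * (3/2)) / (n + 3)"
    have "1 / q (Suc n) = 2 * s + 8 * t - s\<^sup>2 * q n + \<delta>"
      unfolding * \<delta>_def by (simp add: field_simps)
    then have "1 / \<rho> - 1 / q (Suc n) = s\<^sup>2 * (q n - \<rho>) - \<delta>" unfolding inv by (simp add: algebra_simps)
    then have e: "q (Suc n) - \<rho> = (q (Suc n) * \<rho>) * (s\<^sup>2 * (q n - \<rho>) - \<delta>)"
      using q(1)[of "Suc n"] radius by (simp add: field_simps)
    have s2: "0 \<le> s\<^sup>2" "s\<^sup>2 \<le> 1" using s by (auto simp: power_le_one)
    have "\<bar>3 * (s\<^sup>2 * q n) - (2 * s + 8 * t) * (3/2)\<bar> \<le> 3 * (2 * s + 8 * t) + 3"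
    proof -
      have "s\<^sup>2 * q n \<le> 1 * (1/2)"
        using s2 q[of n] by (intro mult_mono) auto
      moreover have "0 \<le> s\<^sup>2 * q n" using s2 q(1)[of n] by simp
      moreover have "\<bar>3 * x - (2 * s + 8 * t) * (3/2)\<bar> \<le> 3 * (2 * s + 8 * t) + 3" if "0 \<le> x" "x \<le> 1/2" for x
        using that s t by (simp add: abs_le_iff field_simps)
      ultimately show ?thesis by simp
    qed
    then have \<delta>: "\<bar>\<delta>\<bar> \<le> d n" unfolding \<delta>_def d_def by (simp add: abs_div divide_right_mono)
    have "\<bar>q (Suc n) - \<rho>\<bar> = (q (Suc n) * \<rho>) * \<bar>s\<^sup>2 * (q n - \<rho>) - \<delta>\<bar>"
      using e q(1)[of "Suc n"] radius by (metis abs_mult abs_of_pos mult_pos_pos)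
    also have "\<dots> \<le> 1/2 * (\<bar>q n - \<rho>\<bar> + d n)"
    proof (rule mult_mono)
      have "q (Suc n) * \<rho> \<le> 1/2 * 1" using q[of "Suc n"] radius by (intro mult_mono) auto
      then show "q (Suc n) * \<rho> \<le> 1/2" by simp
      have "\<bar>s\<^sup>2 * (q n - \<rho>)\<bar> \<le> \<bar>q n - \<rho>\<bar>" using s2 by (simp add: abs_mult mult_left_le_one_le)
      then show "\<bar>s\<^sup>2 * (q n - \<rho>) - \<delta>\<bar> \<le> \<bar>q n - \<rho>\<bar> + d n" using \<delta> by linarith
    qed auto
    also have "\<dots> \<le> 1/2 * \<bar>q n - \<rho>\<bar> + d n" using \<delta> by simp
    finally show ?thesis .
  qed
  have d: "d \<longlonglongrightarrow> 0"
    using LIMSEQ_ignore_initial_segment[OF lim_const_over_n[of "3 * (2 * s + 8 * t) + 3"], of 3]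
    unfolding d_def by simp
  have "q \<longlonglongrightarrow> \<rho>"
  proof (rule near_contraction[of "1/2" 1])
    have "\<bar>q n - \<rho>\<bar> \<le> 1" for n using q[of n] radius by linarith
    then show "near q \<rho> 1" unfolding near_def
      by (intro allI impI always_eventually) (meson add_increasing2 less_imp_le order_trans order_refl)
    fix e :: real assume "0 \<le> e" and n: "near q \<rho> e"
    show "near q \<rho> (1/2 * e)" unfolding near_def
    proof (intro allI impI)
      fix \<epsilon> :: real assume "\<epsilon> > 0"
      then have "\<forall>\<^sub>F n in sequentially. \<bar>q n - \<rho>\<bar> \<le> e + \<epsilon>" using n unfolding near_def by blast
      moreover have "\<forall>\<^sub>F n in sequentially. d n < \<epsilon>/2"
        using order_tendstoD(2)[OF d, of "\<epsilon>/2"] \<open>\<epsilon> > 0\<close> by simp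
      ultimately have "\<forall>\<^sub>F n in sequentially. \<bar>q (Suc n) - \<rho>\<bar> \<le> 1/2 * e + \<epsilon>"
      proof eventually_elim
        case (elim n)
        then show ?case using step[of n] by (simp add: field_simps)
      qed
      then show "\<forall>\<^sub>F n in sequentially. \<bar>q n - \<rho>\<bar> \<le> 1/2 * e + \<epsilon>"
        by (simp only: eventually_sequentially_Suc[of "\<lambda>n. \<bar>q n - \<rho>\<bar> \<le> 1/2 * e + \<epsilon>"])
    qed
  qed auto
  then show ?thesis unfolding q_def .
qed

text \<open>The recurrence is solved for the convolution, so that the ratio limit decides; the value
  agrees because \<open>4 \<rho> \<tau> = 1 - s \<rho>\<close>.\<close>

lemma conv_tendsto: "(\<lambda>n. conv f f n / f n) \<longlonglongrightarrow> 2 * (\<Sum>n. f n * \<rho> ^ n)"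
proof -
  have "(\<lambda>n. (inverse (f n / f (Suc n)) - s) / 2) \<longlonglongrightarrow> (inverse \<rho> - s) / 2"
    using radius by (intro tendsto_intros ratio_tendsto) auto
  moreover have "(inverse (f n / f (Suc n)) - s) / 2 = conv f f n / f n" for n
    using positive[of n] by (simp add: f_Suc field_simps)
  moreover have "(inverse \<rho> - s) / 2 = 2 * (\<Sum>n. f n * \<rho> ^ n)"
    unfolding gf_f \<tau>_def using radius by (simp add: field_simps)
  ultimately show ?thesis by simp
qed

sublocale subexp f \<rho>
  by unfold_locales (use positive radius ratio_tendsto summable_at_rho conv_tendsto in auto)

end

section \<open>Classes of formulas\<close>

definition count :: "fm set \<Rightarrow> nat \<Rightarrow> real" where
  "count S n = real (card (level S n))"

definition binary :: "(fm \<Rightarrow> fm \<Rightarrow> fm) \<Rightarrow> fm set \<Rightarrow> fm set \<Rightarrow> fm set" where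
  "binary c S T = {c p q | p q. p \<in> S \<and> q \<in> T}"

abbreviation imps :: "fm set \<Rightarrow> fm set \<Rightarrow> fm set" where "imps \<equiv> binary Imp"
abbreviation rhds :: "fm set \<Rightarrow> fm set \<Rightarrow> fm set" where "rhds \<equiv> binary Rhd"

definition boxes :: "bool \<Rightarrow> fm set \<Rightarrow> fm set" where
  "boxes b S = (if b then Box ` S else {})"

text \<open>The induction is on the bound \<open>\<le> n\<close>, because immediate subformulas can
  have any smaller complexity.\<close>

lemma finite_level: "finite (level S n)"
proof -
  have "finite {p. complexity p \<le> n}"
  proof (induction n)
    case 0
    have "{p. complexity p \<le> 0} \<subseteq> {\<^bold>\<bottom>, \<^bold>\<top>}"
    proof
      fix p assume "p \<in> {p. complexity p \<le> 0}"
      then show "p \<in> {\<^bold>\<bottom>, \<^bold>\<top>}" by (cases p) auto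
    qed
    then show ?case by (rule finite_subset) simp
  next
    case (Suc n)
    let ?P = "{p. complexity p \<le> n}"
    have "{p. complexity p \<le> Suc n} \<subseteq> {\<^bold>\<bottom>, \<^bold>\<top>} \<union> Box ` ?P \<union> case_prod Imp ` (?P \<times> ?P) \<union> case_prod Rhd ` (?P \<times> ?P)"
    proof
      fix p assume "p \<in> {p. complexity p \<le> Suc n}"
      then show "p \<in> {\<^bold>\<bottom>, \<^bold>\<top>} \<union> Box ` ?P \<union> case_prod Imp ` (?P \<times> ?P) \<union> case_prod Rhd ` (?P \<times> ?P)"
        by (cases p) auto
    qed
    then show ?case by (rule finite_subset) (use Suc in simp)
  qed
  then show ?thesis by (rule rev_finite_subset) (auto simp: level_def)
qed

lemma count_union:
  assumes "S \<inter> T = {}" shows "count (S \<union> T) = (\<lambda>n. count S n + count T n)"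
proof
  fix n
  have "level (S \<union> T) n = level S n \<union> level T n" "level S n \<inter> level T n = {}"
    using assms by (auto simp: level_def)
  then show "count (S \<union> T) n = count S n + count T n"
    by (simp add: count_def card_Un_disjoint finite_level)
qed

lemma count_mono: "S \<subseteq> T \<Longrightarrow> count S n \<le> count T n"
  unfolding count_def by (intro of_nat_mono card_mono finite_level) (auto simp: level_def)

lemma count_binary:
  assumes "\<And>p q p' q'. c p q = c p' q' \<longleftrightarrow> p = p' \<and> q = q'"
    and "\<And>p q. complexity (c p q) = Suc (complexity p + complexity q)"
  shows "count (binary c S T) = shift (conv (count S) (count T))"
proof
  fix n
  show "count (binary c S T) n = shift (conv (count S) (count T)) n"
  proof (cases n)
    case 0
    then have "level (binary c S T) n = {}" using assms(2) by (auto simp: level_def binary_def)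
    then show ?thesis using 0 by (simp add: count_def)
  next
    case (Suc m)
    let ?D = "Sigma {..m} (\<lambda>i. level S i \<times> level T (m - i))"
    have "bij_betw (\<lambda>(i, p, q). c p q) ?D (level (binary c S T) (Suc m))"
      unfolding bij_betw_def
    proof
      show "inj_on (\<lambda>(i, p, q). c p q) ?D"
        by (auto simp: inj_on_def assms(1) level_def)
      show "(\<lambda>(i, p, q). c p q) ` ?D = level (binary c S T) (Suc m)"
      proof
        show "(\<lambda>(i, p, q). c p q) ` ?D \<subseteq> level (binary c S T) (Suc m)"
          by (auto simp: level_def binary_def assms(2))
        show "level (binary c S T) (Suc m) \<subseteq> (\<lambda>(i, p, q). c p q) ` ?D"
        proof
          fix r assume "r \<in> level (binary c S T) (Suc m)"
          then obtain p q where r: "r = c p q" "p \<in> S" "q \<in> T" "complexity p + complexity q = m"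
            by (auto simp: level_def binary_def assms(2))
          then show "r \<in> (\<lambda>(i, p, q). c p q) ` ?D"
            by (intro image_eqI[of _ _ "(complexity p, p, q)"]) (auto simp: level_def)
        qed
      qed
    qed
    then have "card (level (binary c S T) (Suc m)) = card ?D" by (rule bij_betw_same_card[symmetric])
    also have "\<dots> = (\<Sum>i\<le>m. card (level S i) * card (level T (m - i)))"
      by (subst card_SigmaI) (auto simp: finite_level card_cartesian_product)
    finally show ?thesis unfolding Suc shift_simps count_def conv_def by simp
  qed
qed

lemma count_imps: "count (imps S T) = shift (conv (count S) (count T))"
  and count_rhds: "count (rhds S T) = shift (conv (count S) (count T))"
  by (rule count_binary; simp)+

lemma count_boxes: "count (boxes b S) = (\<lambda>n. of_bool b * shift (count S) n)"
proof
  fix n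
  show "count (boxes b S) n = of_bool b * shift (count S) n"
  proof (cases n)
    case 0
    then have "level (boxes b S) n = {}" by (auto simp: level_def boxes_def)
    then show ?thesis using 0 by (simp add: count_def)
  next
    case (Suc m)
    then have "level (boxes b S) n = (if b then Box ` level S m else {})"
      by (auto simp: level_def boxes_def)
    moreover have "inj_on Box (level S m)" by (auto simp: inj_on_def)
    ultimately show ?thesis using Suc by (simp add: count_def card_image)
  qed
qed

lemma count_atoms:
  assumes "S \<subseteq> {\<^bold>\<bottom>, \<^bold>\<top>}"
  shows "count S n = (if n = 0 then real (card S) else 0)"
proof -
  have "complexity p = 0" if "p \<in> S" for p using assms that by auto
  then have "level S n = (if n = 0 then S else {})" by (auto simp: level_def)
  then show ?thesis by (simp add: count_def)
qed

text \<open>The three alphabets are the cases in which \<open>T\<close> is empty or \<open>{\<^bold>\<top>}\<close> and \<open>b\<close> tells whether \<open>\<^bold>\<box>\<close> is present.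
  The equation for \<open>\<rho>\<close> is the vanishing of the discriminant of \<open>F = t + s \<rho> F + 2 \<rho> F\<^sup>2\<close>.\<close>

locale grammar =
  fixes b :: bool and T F A N M X B L G :: "fm set" and \<rho> :: real
  assumes T: "T \<subseteq> {\<^bold>\<top>}"
    and F_eq: "F = {\<^bold>\<bottom>} \<union> T \<union> boxes b F \<union> imps F F \<union> rhds F F"
    and A_eq: "A = T \<union> boxes b F \<union> imps N F \<union> imps F A \<union> rhds F F"
    and N_eq: "N = {\<^bold>\<bottom>} \<union> imps A N"
    and M_eq: "M = boxes b N \<union> rhds A N"
    and X_eq: "X = imps M {\<^bold>\<bottom>}"
    and B_eq: "B = boxes b N \<union> boxes b M \<union> rhds {\<^bold>\<bottom>} F \<union> rhds F A \<union> rhds A {\<^bold>\<bottom>} \<union> rhds N X \<union> rhds X {\<^bold>\<bottom>}"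
    and L_eq: "L = {\<^bold>\<bottom>} \<union> T \<union> B \<union> imps F T \<union> imps L L"
    and G_eq: "G = L \<union> N \<union> M \<union> boxes b G \<union> rhds (imps G {\<^bold>\<bottom>}) {\<^bold>\<bottom>} \<union> imps T G"
    and rho: "0 < \<rho>" "\<rho> < 1"
    and discriminant: "(1 - of_bool b * \<rho>)\<^sup>2 = 8 * (1 + real (card T)) * \<rho>"
begin

lemma finite_T: "finite T"
  using T finite_subset by blast

lemma mem_F: "p \<in> F \<longleftrightarrow> (case p of \<^bold>\<bottom> \<Rightarrow> True | \<^bold>\<top> \<Rightarrow> p \<in> T | \<^bold>\<box> q \<Rightarrow> b \<and> q \<in> F | q \<^bold>\<rightarrow> r \<Rightarrow> q \<in> F \<and> r \<in> F | q \<^bold>\<rhd> r \<Rightarrow> q \<in> F \<and> r \<in> F)"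
  by (subst F_eq) (use T in \<open>auto simp: boxes_def binary_def split: fm.splits\<close>)

lemma mem_A: "p \<in> A \<longleftrightarrow> (case p of \<^bold>\<bottom> \<Rightarrow> False | \<^bold>\<top> \<Rightarrow> p \<in> T | \<^bold>\<box> q \<Rightarrow> b \<and> q \<in> F | q \<^bold>\<rightarrow> r \<Rightarrow> q \<in> N \<and> r \<in> F \<or> q \<in> F \<and> r \<in> A | q \<^bold>\<rhd> r \<Rightarrow> q \<in> F \<and> r \<in> F)"
  by (subst A_eq) (use T in \<open>auto simp: boxes_def binary_def split: fm.splits\<close>)

lemma mem_N: "p \<in> N \<longleftrightarrow> (case p of \<^bold>\<bottom> \<Rightarrow> True | q \<^bold>\<rightarrow> r \<Rightarrow> q \<in> A \<and> r \<in> N | _ \<Rightarrow> False)"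
  by (subst N_eq) (auto simp: binary_def split: fm.splits)

lemma mem_simps [simp]:
  "\<^bold>\<bottom> \<in> F" "\<^bold>\<top> \<in> F \<longleftrightarrow> \<^bold>\<top> \<in> T" "\<^bold>\<box> p \<in> F \<longleftrightarrow> b \<and> p \<in> F" "p \<^bold>\<rightarrow> q \<in> F \<longleftrightarrow> p \<in> F \<and> q \<in> F" "p \<^bold>\<rhd> q \<in> F \<longleftrightarrow> p \<in> F \<and> q \<in> F"
  "\<^bold>\<bottom> \<notin> A" "\<^bold>\<top> \<in> A \<longleftrightarrow> \<^bold>\<top> \<in> T" "\<^bold>\<box> p \<in> A \<longleftrightarrow> b \<and> p \<in> F" "p \<^bold>\<rightarrow> q \<in> A \<longleftrightarrow> p \<in> N \<and> q \<in> F \<or> p \<in> F \<and> q \<in> A" "p \<^bold>\<rhd> q \<in> A \<longleftrightarrow> p \<in> F \<and> q \<in> F"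
  "\<^bold>\<bottom> \<in> N" "\<^bold>\<top> \<notin> N" "\<^bold>\<box> p \<notin> N" "p \<^bold>\<rightarrow> q \<in> N \<longleftrightarrow> p \<in> A \<and> q \<in> N" "p \<^bold>\<rhd> q \<notin> N"
  by (subst mem_F mem_A mem_N; simp)+

text \<open>\<open>A\<close> and \<open>N\<close> act as the truth values true and false under the
  truth table of implication: \<open>Bot\<close> is false, \<open>Top\<close>, boxed formulas and
  \<open>Rhd\<close> formulas are true. Every formula therefore gets exactly one of them.\<close>

lemma A_N_partition: "(p \<in> F \<longleftrightarrow> p \<in> A \<or> p \<in> N) \<and> \<not> (p \<in> A \<and> p \<in> N)"
proof (induction p)
  case (Imp p q)
  then show ?case unfolding mem_simps by blast
qed auto

lemma A_conv: "A = F - N" and N_subset: "N \<subseteq> F" and A_subset: "A \<subseteq> F" and A_N_disjoint: "A \<inter> N = {}"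
  using A_N_partition by blast+

sublocale tree_count "count F" "of_bool b" "1 + real (card T)" \<rho>
proof
  have "count F = count ({\<^bold>\<bottom>} \<union> T \<union> boxes b F \<union> imps F F \<union> rhds F F)" by (rule arg_cong[OF F_eq])
  also have "\<dots> = (\<lambda>n. count ({\<^bold>\<bottom>} \<union> T) n + count (boxes b F) n + count (imps F F) n + count (rhds F F) n)"
  proof -
    have 1: "({\<^bold>\<bottom>} \<union> T) \<inter> boxes b F = {}" using T by (auto simp: boxes_def)
    have 2: "({\<^bold>\<bottom>} \<union> T \<union> boxes b F) \<inter> imps F F = {}" using T by (auto simp: boxes_def binary_def)
    have 3: "({\<^bold>\<bottom>} \<union> T \<union> boxes b F \<union> imps F F) \<inter> rhds F F = {}" using T by (auto simp: boxes_def binary_def)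
    show ?thesis by (simp only: count_union[OF 1] count_union[OF 2] count_union[OF 3])
  qed
  finally have eq: "count F = \<dots>" .
  have F: "count F n = count ({\<^bold>\<bottom>} \<union> T) n + of_bool b * shift (count F) n + 2 * shift (conv (count F) (count F)) n" for n
    by (subst fun_cong[OF eq, of n]) (simp add: count_boxes count_imps count_rhds)
  have "card ({\<^bold>\<bottom>} \<union> T) = Suc (card T)" using T finite_T by (subst card_Un_disjoint) auto
  moreover have "{\<^bold>\<bottom>} \<union> T \<subseteq> {\<^bold>\<bottom>, \<^bold>\<top>}" using T by auto
  ultimately have atoms: "count ({\<^bold>\<bottom>} \<union> T) n = (if n = 0 then 1 + real (card T) else 0)" for n
    using count_atoms[of "{\<^bold>\<bottom>} \<union> T" n] by simp
  show "count F 0 = 1 + real (card T)" unfolding F[of 0] atoms by simp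
  show "count F (Suc n) = of_bool b * count F n + 2 * conv (count F) (count F) n" for n
    unfolding F[of "Suc n"] atoms by simp
qed (use rho discriminant in auto)

end

section \<open>Inclusions between the classes and removal of overlaps\<close>

context grammar
begin

lemma mem_M [simp]:
  "\<^bold>\<bottom> \<notin> M" "\<^bold>\<top> \<notin> M" "\<^bold>\<box> p \<in> M \<longleftrightarrow> b \<and> p \<in> N" "p \<^bold>\<rightarrow> q \<notin> M" "p \<^bold>\<rhd> q \<in> M \<longleftrightarrow> p \<in> A \<and> q \<in> N"
  by (subst M_eq; auto simp: boxes_def binary_def)+

lemma mem_X [simp]:
  "\<^bold>\<bottom> \<notin> X" "\<^bold>\<top> \<notin> X" "\<^bold>\<box> p \<notin> X" "p \<^bold>\<rightarrow> q \<in> X \<longleftrightarrow> p \<in> M \<and> q = \<^bold>\<bottom>" "p \<^bold>\<rhd> q \<notin> X"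
  by (subst X_eq; auto simp: binary_def)+

lemma mem_B [simp]:
  "\<^bold>\<bottom> \<notin> B" "\<^bold>\<top> \<notin> B" "\<^bold>\<box> p \<in> B \<longleftrightarrow> b \<and> (p \<in> N \<or> p \<in> M)" "p \<^bold>\<rightarrow> q \<notin> B"
  "p \<^bold>\<rhd> q \<in> B \<longleftrightarrow> p = \<^bold>\<bottom> \<and> q \<in> F \<or> p \<in> F \<and> q \<in> A \<or> p \<in> A \<and> q = \<^bold>\<bottom> \<or> p \<in> N \<and> q \<in> X \<or> p \<in> X \<and> q = \<^bold>\<bottom>"
  by (subst B_eq; auto simp: boxes_def binary_def)+

lemma not_mem_T [simp]: "\<^bold>\<bottom> \<notin> T" "\<^bold>\<box> p \<notin> T" "p \<^bold>\<rightarrow> q \<notin> T" "p \<^bold>\<rhd> q \<notin> T"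
  using T by auto

lemma mem_L [simp]:
  "\<^bold>\<bottom> \<in> L" "\<^bold>\<top> \<in> L \<longleftrightarrow> \<^bold>\<top> \<in> T" "\<^bold>\<box> p \<in> L \<longleftrightarrow> \<^bold>\<box> p \<in> B" "p \<^bold>\<rightarrow> q \<in> L \<longleftrightarrow> p \<in> F \<and> q \<in> T \<or> p \<in> L \<and> q \<in> L"
  "p \<^bold>\<rhd> q \<in> L \<longleftrightarrow> p \<^bold>\<rhd> q \<in> B"
  by (subst L_eq; auto simp: binary_def)+

lemma mem_G [simp]:
  "\<^bold>\<bottom> \<in> G" "\<^bold>\<top> \<in> G \<longleftrightarrow> \<^bold>\<top> \<in> T" "\<^bold>\<box> p \<in> G \<longleftrightarrow> \<^bold>\<box> p \<in> L \<or> b \<and> (p \<in> N \<or> p \<in> G)"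
  "p \<^bold>\<rightarrow> q \<in> G \<longleftrightarrow> p \<^bold>\<rightarrow> q \<in> L \<or> p \<^bold>\<rightarrow> q \<in> N \<or> p \<in> T \<and> q \<in> G"
  "p \<^bold>\<rhd> q \<in> G \<longleftrightarrow> p \<^bold>\<rhd> q \<in> L \<or> p \<^bold>\<rhd> q \<in> M \<or> (\<exists>r\<in>G. p = r \<^bold>\<rightarrow> \<^bold>\<bottom>) \<and> q = \<^bold>\<bottom>"
  by (subst G_eq; auto simp: boxes_def binary_def)+

lemma T_subset: "T \<subseteq> F" "T \<subseteq> A" "T \<subseteq> L"
  using T by auto

lemma M_subset_A: "M \<subseteq> A"
proof
  fix p assume "p \<in> M" then show "p \<in> A" using A_subset N_subset by (cases p) auto
qed

lemma X_subset_N: "X \<subseteq> N"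
proof
  fix p assume "p \<in> X" then show "p \<in> N" using M_subset_A by (cases p) auto
qed

lemma L_subset: "L \<subseteq> F"
proof
  fix p show "p \<in> L \<Longrightarrow> p \<in> F"
  proof (induction p)
    case (Imp p q)
    then show ?case using T_subset by auto
  qed (use A_subset N_subset M_subset_A X_subset_N in auto)
qed

text \<open>Induction on complexity rather than structure, since a production passes from
  \<open>r\<close> to \<open>Rhd (Imp r Bot) Bot\<close>, two levels up.\<close>

lemma G_subset: "G \<subseteq> F"
proof
  fix p have "p \<in> G \<Longrightarrow> p \<in> F"
  proof (induction "complexity p" arbitrary: p rule: less_induct)
    case less
    have "p \<in> L \<or> p \<in> N \<or> p \<in> M \<or> p \<in> boxes b G \<or> p \<in> rhds (imps G {\<^bold>\<bottom>}) {\<^bold>\<bottom>} \<or> p \<in> imps T G"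
      using less(2) by (subst (asm) G_eq) blast
    then show ?case using L_subset N_subset M_subset_A A_subset less(1) T_subset
      by (auto simp: boxes_def binary_def split: if_splits)
  qed
  then show "p \<in> G \<Longrightarrow> p \<in> F" .
qed

text \<open>The overlap of two alternatives for \<open>G\<close>, to be counted only once.\<close>

definition C :: "fm set" where "C = L \<inter> N"

lemma A_N_cases: "p \<in> F \<Longrightarrow> p \<notin> A \<Longrightarrow> p \<in> N" "p \<in> A \<Longrightarrow> p \<in> N \<Longrightarrow> False"
  using A_N_partition by blast+

text \<open>The productions overlap; the following decompositions are into disjoint sets.\<close>

lemma C_decomp: "C = {\<^bold>\<bottom>} \<union> imps (L - C) C"
proof (rule set_eqI)
  \<comment> \<open>An implication in \<open>N\<close> has its antecedent in \<open>A\<close> and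
    its consequent in \<open>N\<close>; within \<open>L\<close> these are \<open>L - C\<close> and
    \<open>C\<close>. An implication into \<open>T\<close> lies in \<open>A\<close> and cannot
    interfere.\<close>
  fix p show "p \<in> C \<longleftrightarrow> p \<in> {\<^bold>\<bottom>} \<union> imps (L - C) C"
    using A_N_cases L_subset T_subset(2) unfolding C_def by (cases p) (auto simp: binary_def)
qed

text \<open>\<open>rhds {Bot} A\<close> lies in \<open>rhds F A\<close>, which leaves
  \<open>rhds {Bot} N\<close>. As \<open>X\<close> is contained in \<open>N\<close>, this covers
  \<open>rhds {Bot} X\<close>, so \<open>Bot\<close> is removed on the left of
  \<open>X\<close>.\<close>

lemma B_decomp: "B = boxes b N \<union> boxes b M \<union> rhds {\<^bold>\<bottom>} N \<union> rhds F A \<union> rhds A {\<^bold>\<bottom>} \<union> rhds (N - {\<^bold>\<bottom>}) X \<union> rhds X {\<^bold>\<bottom>}"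
proof (rule set_eqI)
  fix p show "p \<in> B \<longleftrightarrow> p \<in> boxes b N \<union> boxes b M \<union> rhds {\<^bold>\<bottom>} N \<union> rhds F A \<union> rhds A {\<^bold>\<bottom>} \<union> rhds (N - {\<^bold>\<bottom>}) X \<union> rhds X {\<^bold>\<bottom>}"
    using A_N_cases A_subset N_subset X_subset_N by (cases p) (auto simp: binary_def boxes_def)
qed

text \<open>The two implication productions meet in \<open>imps L T\<close>, because
  \<open>T\<close> is contained in both \<open>F\<close> and \<open>L\<close>.\<close>

lemma L_decomp: "L = {\<^bold>\<bottom>} \<union> T \<union> B \<union> imps F T \<union> imps L (L - T)"
proof (rule set_eqI)
  fix p show "p \<in> L \<longleftrightarrow> p \<in> {\<^bold>\<bottom>} \<union> T \<union> B \<union> imps F T \<union> imps L (L - T)"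
    using L_subset by (cases p) (auto simp: binary_def)
qed

text \<open>Boxes of \<open>N\<close> and of \<open>M\<close>, and \<open>rhds A {Bot}\<close>,
  already belong to \<open>B\<close>. For r in \<open>N\<close>, \<open>Imp r Bot\<close> is in
  \<open>A\<close>, and for r in \<open>M\<close> it is in \<open>X\<close>; both ways
  \<open>Rhd (Imp r Bot) Bot\<close> is in \<open>B\<close>. Prefixing \<open>Top\<close> maps
  \<open>N\<close> into \<open>N\<close> and \<open>L\<close> into \<open>L\<close>. What remains of
  each production is new.\<close>

lemma G_decomp: "G = (L - C) \<union> N \<union> rhds A (N - {\<^bold>\<bottom>}) \<union> boxes b (G - N - M)
    \<union> rhds (imps (G - N - M) {\<^bold>\<bottom>}) {\<^bold>\<bottom>} \<union> imps T (G - N - (L - C))" (is "_ = ?R")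
proof (rule set_eqI)
  fix p show "p \<in> G \<longleftrightarrow> p \<in> ?R"
  proof (cases p)
    case (Imp q r)
    have "r \<in> L \<Longrightarrow> q \<in> T \<Longrightarrow> q \<in> L" using T_subset by auto
    then show ?thesis using Imp T_subset A_N_cases(2) L_subset unfolding C_def by (auto simp: binary_def boxes_def)
  next
    case (Rhd q r)
    then show ?thesis using A_N_cases A_subset N_subset X_subset_N M_subset_A unfolding C_def by (auto simp: binary_def boxes_def)
  qed (auto simp: C_def binary_def boxes_def)
qed

text \<open>\<open>g\<close> is the generating function at \<open>\<rho>\<close>, \<open>\<sigma>\<close> the claimed density of \<open>S\<close> in \<open>F\<close>, \<open>e\<close> its error.\<close>

definition has :: "fm set \<Rightarrow> real \<Rightarrow> real \<Rightarrow> real \<Rightarrow> bool" where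
  "has S g \<sigma> e \<longleftrightarrow> S \<subseteq> F \<and> gf (count S) = g \<and> close (count S) \<sigma> e \<and> 0 \<le> e"

lemma dominated_count: "S \<subseteq> F \<Longrightarrow> dominated (count S)"
  unfolding dominated_def by (auto intro: count_mono) (simp add: count_def)

lemmas summable_count = dominated_summable[OF dominated_count]

lemma has_union:
  assumes "has S g \<sigma> d" "has U h \<upsilon> e" "S \<inter> U = {}"
  shows "has (S \<union> U) (g + h) (\<sigma> + \<upsilon>) (d + e)"
  using assms gf_add[OF summable_count summable_count, of S U] close_add[of "count S" \<sigma> d "count U" \<upsilon> e]
  unfolding has_def count_union[OF assms(3)] by auto

lemma has_diff:
  assumes "has S g \<sigma> d" "has U h \<upsilon> e" "U \<subseteq> S"
  shows "has (S - U) (g - h) (\<sigma> - \<upsilon>) (d + e)"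
proof -
  have S: "S = U \<union> (S - U)" and disj: "U \<inter> (S - U) = {}" using assms(3) by auto
  have c: "count S = (\<lambda>n. count U n + count (S - U) n)"
    using count_union[OF disj] S by simp
  have sub: "S - U \<subseteq> F" "U \<subseteq> F" using assms by (auto simp: has_def)
  have "gf (count S) = gf (count U) + gf (count (S - U))"
    unfolding c by (rule gf_add[OF summable_count summable_count]) (rule sub)+
  moreover have "close (\<lambda>n. count S n + - count U n) (\<sigma> + - \<upsilon>) (d + e)"
    using assms by (intro close_add close_minus) (auto simp: has_def)
  then have "close (count (S - U)) (\<sigma> - \<upsilon>) (d + e)" unfolding c by simp
  ultimately show ?thesis using sub assms by (auto simp: has_def)
qed

lemma
  assumes "has S g \<sigma> d" "has U h \<upsilon> e"
  shows has_imps: "has (imps S U) (\<rho> * (g * h)) (\<rho> * (\<sigma> * h + \<upsilon> * g)) (\<rho> * (h * d + g * e))"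
    and has_rhds: "has (rhds S U) (\<rho> * (g * h)) (\<rho> * (\<sigma> * h + \<upsilon> * g)) (\<rho> * (h * d + g * e))"
proof -
  have d: "dominated (count S)" "dominated (count U)" using assms by (auto simp: has_def dominated_count)
  have g: "gf (count S) = g" "gf (count U) = h" using assms by (auto simp: has_def)
  have nn: "0 \<le> h * d + g * e" using gf_nonneg[OF d(1)] gf_nonneg[OF d(2)] assms unfolding g by (simp add: has_def)
  have "close (shift (conv (count S) (count U))) (\<rho> * (\<sigma> * h + \<upsilon> * g)) (\<rho> * (h * d + g * e))"
    using close_conv[OF d(1) _ _ d(2), of \<sigma> d \<upsilon> e] assms nn unfolding g by (intro close_shift) (auto simp: has_def)
  moreover have "gf (shift (conv (count S) (count U))) = \<rho> * (g * h)"
    by (simp add: gf_shift[OF summable_conv[OF d]] gf_conv[OF d] g)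
  moreover have "imps S U \<subseteq> F" "rhds S U \<subseteq> F" using assms by (auto simp: has_def binary_def)
  ultimately show "has (imps S U) (\<rho> * (g * h)) (\<rho> * (\<sigma> * h + \<upsilon> * g)) (\<rho> * (h * d + g * e))"
    "has (rhds S U) (\<rho> * (g * h)) (\<rho> * (\<sigma> * h + \<upsilon> * g)) (\<rho> * (h * d + g * e))"
    using nn rho by (auto simp: has_def count_imps count_rhds)
qed

lemma has_atoms:
  assumes "S \<subseteq> {\<^bold>\<bottom>} \<union> T" shows "has S (real (card S)) 0 0"
proof -
  have at: "S \<subseteq> {\<^bold>\<bottom>, \<^bold>\<top>}" using assms T by auto
  have "gf (count S) = (\<Sum>n\<in>{0}. count S n * \<rho> ^ n)"
    unfolding gf_def by (rule suminf_finite) (auto simp: count_atoms[OF at])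
  then have "gf (count S) = real (card S)" by (simp add: count_atoms[OF at])
  moreover have "(\<lambda>n. count S n / count F n) \<longlonglongrightarrow> 0"
    by (rule tendsto_eventually) (use eventually_gt_at_top[of 0] in eventually_elim, simp add: count_atoms[OF at])
  moreover have "S \<subseteq> F" using assms T_subset by auto
  ultimately show ?thesis by (simp add: has_def close_def near_zero_iff)
qed

lemma has_boxes:
  assumes "has S g \<sigma> e"
  shows "has (boxes b S) (of_bool b * (\<rho> * g)) (of_bool b * (\<rho> * \<sigma>)) (of_bool b * (\<rho> * e))"
proof (cases b)
  case True
  have "boxes b S \<subseteq> F" using assms True by (auto simp: boxes_def has_def)
  then show ?thesis
    using assms True rho close_shift[of "count S" \<sigma> e] gf_shift[OF summable_count, of S]
    by (simp add: has_def count_boxes)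
next
  case False
  then show ?thesis using has_atoms[of "{}"] by (simp add: boxes_def)
qed

lemma has_F: "has F (gf (count F)) 1 0"
  by (simp add: has_def close_def near_zero_iff)

text \<open>One pass through a disjoint decomposition must reproduce the density and shrink an
  arbitrary error. The value \<open>g\<close> is left open: comparing it with
  \<open>gf (count S)\<close> afterwards yields the generating function equation of \<open>S\<close>
  from the same step.\<close>

lemma has_fixpoint:
  assumes "S \<subseteq> F" "0 \<le> c" "c < 1"
    and "\<And>e. has S (gf (count S)) \<sigma> e \<Longrightarrow> has S g \<sigma> (c * e)"
  shows "has S (gf (count S)) \<sigma> 0"
  using close_contraction[OF dominated_count[OF assms(1)] assms(2,3)] assms(1,4)
  by (auto simp: has_def)

lemma has_gf: "has S g \<sigma> e \<Longrightarrow> gf (count S) = g"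
  by (simp add: has_def)

subsection \<open>Densities of the classes\<close>

text \<open>\<open>gfun S\<close> is the generating function of \<open>S\<close> at \<open>\<rho>\<close>. The densities \<open>dN\<close>, \<dots>, \<open>dG\<close> solve the
  linear equations obtained by differentiating the generating function equations with respect to \<open>F\<close>.\<close>

abbreviation "gfun S \<equiv> gf (count S)"
abbreviation k :: real where "k \<equiv> real (card T)"
abbreviation s :: real where "s \<equiv> of_bool b"

definition dN :: real where "dN = \<rho> * gfun N / (1 + \<rho> * gfun N - \<rho> * gfun A)"
definition dA :: real where "dA = 1 - dN"
definition dM :: real where "dM = s * (\<rho> * dN) + \<rho> * (dA * gfun N + dN * gfun A)"
definition dX :: real where "dX = \<rho> * dM"
definition dB :: real where
  "dB = \<rho> * (s * (dN + dM) + dN + gfun A + dA * gfun F + dA + dN * gfun X + dX * gfun N)"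
definition dL :: real where "dL = (dB + \<rho> * k) / (1 + \<rho> * k - 2 * (\<rho> * gfun L))"
definition dC :: real where "dC = \<rho> * (dL * gfun C) / (1 + 2 * (\<rho> * gfun C) - \<rho> * gfun L)"
definition dG :: real where
  "dG = (dL - dC + dN + \<rho> * (dA * (gfun N - 1) + dN * gfun A)
         - (s * \<rho> + \<rho> * \<rho>) * (dN + dM) - \<rho> * (k * (dN + dL - dC))) / (1 - s * \<rho> - \<rho> * \<rho> - \<rho> * k)"

lemma gfun_F: "\<rho> * gfun F = (1 - s * \<rho>) / 4"
  using gf_f rho unfolding gf_def \<tau>_def by simp

lemma rho_gfun_le: assumes "S \<subseteq> F" shows "0 \<le> \<rho> * gfun S" "\<rho> * gfun S \<le> 1/4"
proof -
  show "0 \<le> \<rho> * gfun S" using gf_nonneg[OF dominated_count[OF assms]] rho by simp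
  have "\<rho> * gfun S \<le> \<rho> * gfun F" using gf_le[OF dominated_count[OF assms]] rho by simp
  then show "\<rho> * gfun S \<le> 1/4" using gfun_F s_rho by (simp add: field_simps)
qed

lemma C_subset: "C \<subseteq> F" "C \<subseteq> L"
  using N_subset unfolding C_def by auto

lemma has_bot: "has {\<^bold>\<bottom>} 1 0 0" and has_T: "has T k 0 0"
  using has_atoms[of "{\<^bold>\<bottom>}"] has_atoms[of T] by auto

lemma has_A_of_N: "has N g \<sigma> e \<Longrightarrow> has A (gfun F - g) (1 - \<sigma>) e"
  using has_diff[OF has_F _ N_subset] unfolding A_conv by fastforce

text \<open>\<open>A\<close> inherits the error of \<open>N\<close>, so the contributions
  \<open>g * e\<close> and \<open>(gfun F - g) * e\<close> add up to
  \<open>gfun F * e\<close>.\<close>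

lemma has_N_step:
  assumes "has N g \<sigma> e"
  shows "has N (1 + \<rho> * ((gfun F - g) * g)) (\<rho> * ((1 - \<sigma>) * g + \<sigma> * (gfun F - g))) (\<rho> * gfun F * e)"
proof -
  have "has ({\<^bold>\<bottom>} \<union> imps A N) (1 + \<rho> * ((gfun F - g) * g)) (0 + \<rho> * ((1 - \<sigma>) * g + \<sigma> * (gfun F - g)))
     (0 + \<rho> * (g * e + (gfun F - g) * e))"
    by (intro has_union has_bot has_imps has_A_of_N assms) (auto simp: binary_def)
  then show ?thesis unfolding N_eq[symmetric] by (simp add: algebra_simps)
qed

lemma has_N: "has N (gfun N) dN 0"
proof (rule has_fixpoint[OF N_subset, of "\<rho> * gfun F"])
  have "1 + \<rho> * gfun N - \<rho> * gfun A > 0" using rho_gfun_le[OF N_subset] rho_gfun_le[OF A_subset] by linarith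
  then have "dN * (1 + \<rho> * gfun N - \<rho> * gfun A) = \<rho> * gfun N" unfolding dN_def by simp
  then have fix_N: "\<rho> * ((1 - dN) * gfun N + dN * gfun A) = dN" by (simp add: algebra_simps)
  fix e assume h: "has N (gfun N) dN e"
  have "gfun A = gfun F - gfun N" using has_gf[OF has_A_of_N[OF h]] .
  then show "has N (1 + \<rho> * ((gfun F - gfun N) * gfun N)) dN (\<rho> * gfun F * e)" using has_N_step[OF h] fix_N by simp
qed (use rho_gfun_le[OF order_refl] in auto)

lemma gfun_A: "gfun A = gfun F - gfun N" and has_A: "has A (gfun A) dA 0"
  using has_A_of_N[OF has_N] has_gf[OF has_A_of_N[OF has_N]] unfolding dA_def by auto

lemma gfun_N: "gfun N = 1 + \<rho> * ((gfun F - gfun N) * gfun N)"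
  using has_gf[OF has_N_step[OF has_N]] .

lemma gfun_M: "gfun M = s * (\<rho> * gfun N) + \<rho> * (gfun A * gfun N)" and has_M: "has M (gfun M) dM 0"
proof -
  have "has (boxes b N \<union> rhds A N) (s * (\<rho> * gfun N) + \<rho> * (gfun A * gfun N)) (s * (\<rho> * dN) + \<rho> * (dA * gfun N + dN * gfun A))
     (s * (\<rho> * 0) + \<rho> * (gfun N * 0 + gfun A * 0))"
    by (intro has_union has_boxes has_rhds has_N has_A) (auto simp: binary_def boxes_def)
  then have *: "has M (s * (\<rho> * gfun N) + \<rho> * (gfun A * gfun N)) dM 0" unfolding M_eq[symmetric] dM_def by simp
  show "gfun M = s * (\<rho> * gfun N) + \<rho> * (gfun A * gfun N)" using has_gf[OF *] .
  with * show "has M (gfun M) dM 0" by simp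
qed

lemma gfun_X: "gfun X = \<rho> * gfun M" and has_X: "has X (gfun X) dX 0"
proof -
  have "has X (\<rho> * (gfun M * 1)) (\<rho> * (dM * 1 + 0 * gfun M)) (\<rho> * (1 * 0 + gfun M * 0))"
    unfolding X_eq by (intro has_imps has_M has_bot)
  then have *: "has X (\<rho> * gfun M) dX 0" unfolding dX_def by simp
  show "gfun X = \<rho> * gfun M" using has_gf[OF *] .
  with * show "has X (gfun X) dX 0" by simp
qed

lemma gfun_B: "gfun B = \<rho> * (s * (gfun N + gfun M) + gfun F * gfun A + gfun F + gfun N * gfun X)"
  and has_B: "has B (gfun B) dB 0"
proof -
  have disj: "A \<inter> {\<^bold>\<bottom>} = {}" "M \<inter> N = {}" "X \<inter> A = {}" "{\<^bold>\<bottom>} \<inter> X = {}" "X \<inter> {\<^bold>\<bottom>} = {}"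
    using M_subset_A X_subset_N A_N_disjoint by auto
  have "has (boxes b N \<union> boxes b M \<union> rhds {\<^bold>\<bottom>} N \<union> rhds F A \<union> rhds A {\<^bold>\<bottom>} \<union> rhds (N - {\<^bold>\<bottom>}) X \<union> rhds X {\<^bold>\<bottom>})
     (s * (\<rho> * gfun N) + s * (\<rho> * gfun M) + \<rho> * (1 * gfun N) + \<rho> * (gfun F * gfun A) + \<rho> * (gfun A * 1)
        + \<rho> * ((gfun N - 1) * gfun X) + \<rho> * (gfun X * 1))
     (s * (\<rho> * dN) + s * (\<rho> * dM) + \<rho> * (0 * gfun N + dN * 1) + \<rho> * (1 * gfun A + dA * gfun F) + \<rho> * (dA * 1 + 0 * gfun A)
        + \<rho> * ((dN - 0) * gfun X + dX * (gfun N - 1)) + \<rho> * (dX * 1 + 0 * gfun X))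
     (s * (\<rho> * 0) + s * (\<rho> * 0) + \<rho> * (gfun N * 0 + 1 * 0) + \<rho> * (gfun A * 0 + gfun F * 0) + \<rho> * (1 * 0 + gfun A * 0)
        + \<rho> * (gfun X * (0 + 0) + (gfun N - 1) * 0) + \<rho> * (1 * 0 + gfun X * 0))"
    by (intro has_union has_boxes has_rhds has_diff has_N has_A has_M has_X has_bot has_F)
      (use disj A_N_disjoint in \<open>auto simp: binary_def boxes_def\<close>)
  \<comment> \<open>\<open>gfun N + gfun A = gfun F\<close> merges \<open>rhds {Bot} N\<close> with
    \<open>rhds A {Bot}\<close>, and the two terms in \<open>X\<close> recombine to
    \<open>gfun N * gfun X\<close>.\<close>
  moreover have "(s * (\<rho> * gfun N) + s * (\<rho> * gfun M) + \<rho> * (1 * gfun N) + \<rho> * (gfun F * gfun A) + \<rho> * (gfun A * 1)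
        + \<rho> * ((gfun N - 1) * gfun X) + \<rho> * (gfun X * 1)) =
      \<rho> * (s * (gfun N + gfun M) + gfun F * gfun A + gfun F + gfun N * gfun X)"
    using gfun_A by algebra
  moreover have "(s * (\<rho> * dN) + s * (\<rho> * dM) + \<rho> * (0 * gfun N + dN * 1) + \<rho> * (1 * gfun A + dA * gfun F) + \<rho> * (dA * 1 + 0 * gfun A)
        + \<rho> * ((dN - 0) * gfun X + dX * (gfun N - 1)) + \<rho> * (dX * 1 + 0 * gfun X)) = dB"
    unfolding dB_def by algebra
  ultimately have *: "has B (\<rho> * (s * (gfun N + gfun M) + gfun F * gfun A + gfun F + gfun N * gfun X)) dB 0"
    unfolding B_decomp[symmetric] by simp
  show "gfun B = \<rho> * (s * (gfun N + gfun M) + gfun F * gfun A + gfun F + gfun N * gfun X)" using has_gf[OF *] .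
  with * show "has B (gfun B) dB 0" by simp
qed

lemma has_L_step:
  assumes "has L g \<sigma> e"
  shows "has L (1 + k + gfun B + \<rho> * (k * gfun F) + \<rho> * (g * (g - k))) (dB + \<rho> * k + \<rho> * (\<sigma> * (2 * g - k))) (\<rho> * (2 * g - k) * e)"
proof -
  have "has ({\<^bold>\<bottom>} \<union> T \<union> B \<union> imps F T \<union> imps L (L - T))
     (1 + k + gfun B + \<rho> * (gfun F * k) + \<rho> * (g * (g - k)))
     (0 + 0 + dB + \<rho> * (1 * k + 0 * gfun F) + \<rho> * (\<sigma> * (g - k) + (\<sigma> - 0) * g))
     (0 + 0 + 0 + \<rho> * (k * 0 + gfun F * 0) + \<rho> * ((g - k) * e + g * (e + 0)))"
    by (intro has_union has_imps has_diff has_bot has_T has_B has_F assms)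
      (use T_subset T in \<open>auto simp: binary_def\<close>)
  then show ?thesis unfolding L_decomp[symmetric] by (simp add: algebra_simps)
qed

text \<open>Both factors of \<open>imps L (L - T)\<close> carry the error, so the contraction factor
  is \<open>\<rho> * (2 * gfun L - k)\<close>, at most 1/2; it is nonnegative because
  \<open>T\<close> is contained in \<open>L\<close>.\<close>

lemma has_L: "has L (gfun L) dL 0"
proof (rule has_fixpoint[OF L_subset, of "\<rho> * (2 * gfun L - k)"])
  have sub: "L - T \<subseteq> F" "T \<union> (L - T) = L" using L_subset T_subset by auto
  have "gfun L = k + gfun (L - T)"
    using gf_add[OF summable_count summable_count, OF T_subset(1) sub(1)] count_union[of T "L - T"] has_gf[OF has_T] sub(2) by simp
  then have k: "k \<le> gfun L" using gf_nonneg[OF dominated_count[OF sub(1)]] by simp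
  have r: "\<rho> * gfun L \<le> 1/4" "0 \<le> \<rho> * k" using rho_gfun_le[OF L_subset] rho by auto
  show "0 \<le> \<rho> * (2 * gfun L - k)" using k rho by simp
  show "\<rho> * (2 * gfun L - k) < 1" using r by (simp add: right_diff_distrib)
  have "1 + \<rho> * k - 2 * (\<rho> * gfun L) > 0" using r by linarith
  then have "dL * (1 + \<rho> * k - 2 * (\<rho> * gfun L)) = dB + \<rho> * k" unfolding dL_def by simp
  then have fix_L: "dB + \<rho> * k + \<rho> * (dL * (2 * gfun L - k)) = dL" by (simp add: algebra_simps)
  fix e assume h: "has L (gfun L) dL e"
  show "has L (1 + k + gfun B + \<rho> * (k * gfun F) + \<rho> * (gfun L * (gfun L - k))) dL (\<rho> * (2 * gfun L - k) * e)"
    using has_L_step[OF h] unfolding fix_L .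
qed

lemma gfun_L: "gfun L = 1 + k + gfun B + \<rho> * (k * gfun F) + \<rho> * (gfun L * (gfun L - k))"
  using has_gf[OF has_L_step[OF has_L]] .

text \<open>The argument for \<open>N\<close> with \<open>L\<close> in the role of \<open>F\<close>
  and \<open>L - C\<close> in that of \<open>A\<close>.\<close>

lemma has_C_step:
  assumes "has C g \<sigma> e"
  shows "has C (1 + \<rho> * ((gfun L - g) * g)) (\<rho> * ((dL - \<sigma>) * g + \<sigma> * (gfun L - g))) (\<rho> * gfun L * e)"
proof -
  have "has ({\<^bold>\<bottom>} \<union> imps (L - C) C) (1 + \<rho> * ((gfun L - g) * g)) (0 + \<rho> * ((dL - \<sigma>) * g + \<sigma> * (gfun L - g)))
     (0 + \<rho> * (g * (0 + e) + (gfun L - g) * e))"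
    by (intro has_union has_bot has_imps has_diff has_L C_subset assms) (auto simp: binary_def)
  then show ?thesis unfolding C_decomp[symmetric] by (simp add: algebra_simps)
qed

lemma has_C: "has C (gfun C) dC 0"
proof (rule has_fixpoint[OF C_subset(1), of "\<rho> * gfun L"])
  have "1 + 2 * (\<rho> * gfun C) - \<rho> * gfun L > 0" using rho_gfun_le[OF C_subset(1)] rho_gfun_le[OF L_subset] by linarith
  then have "dC * (1 + 2 * (\<rho> * gfun C) - \<rho> * gfun L) = \<rho> * (dL * gfun C)" unfolding dC_def by simp
  then have fix_C: "\<rho> * ((dL - dC) * gfun C + dC * (gfun L - gfun C)) = dC" by (simp add: algebra_simps)
  fix e assume h: "has C (gfun C) dC e"
  show "has C (1 + \<rho> * ((gfun L - gfun C) * gfun C)) dC (\<rho> * gfun L * e)" using has_C_step[OF h] unfolding fix_C .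
qed (use rho_gfun_le[OF L_subset] in auto)

lemma gfun_C: "gfun C = 1 + \<rho> * ((gfun L - gfun C) * gfun C)"
  using has_gf[OF has_C_step[OF has_C]] .

text \<open>\<open>G\<close> occurs only linearly, multiplied by finite sets of density zero. Hence
  its generating function value enters neither the density equation nor the contraction factor and
  may stay existentially quantified.\<close>

lemma has_G_step:
  assumes "has G g \<sigma> e"
  shows "\<exists>h. has G h (dL - dC + dN + \<rho> * (dA * (gfun N - 1) + dN * gfun A) + (s * \<rho> + \<rho> * \<rho>) * (\<sigma> - dN - dM)
            + \<rho> * (k * (\<sigma> - dN - (dL - dC)))) ((s * \<rho> + \<rho> * \<rho> + \<rho> * k) * e)"
proof -
  have "L \<union> N \<union> M \<subseteq> G" by (subst G_eq) blast
  then have N: "N \<subseteq> G" and M: "M \<subseteq> G - N" and L: "L - C \<subseteq> G - N"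
    using M_subset_A A_N_disjoint by (auto simp: C_def)
  have disj: "p \<in> A \<Longrightarrow> p \<in> N \<Longrightarrow> False" for p using A_N_disjoint by auto
  have "has ((L - C) \<union> N \<union> rhds A (N - {\<^bold>\<bottom>}) \<union> boxes b (G - N - M)
      \<union> rhds (imps (G - N - M) {\<^bold>\<bottom>}) {\<^bold>\<bottom>} \<union> imps T (G - N - (L - C)))
    (gfun L - gfun C + gfun N + \<rho> * (gfun A * (gfun N - 1)) + s * (\<rho> * (g - gfun N - gfun M))
      + \<rho> * (\<rho> * ((g - gfun N - gfun M) * 1) * 1) + \<rho> * (k * (g - gfun N - (gfun L - gfun C))))
    (dL - dC + dN + \<rho> * (dA * (gfun N - 1) + (dN - 0) * gfun A) + s * (\<rho> * (\<sigma> - dN - dM))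
      + \<rho> * (\<rho> * ((\<sigma> - dN - dM) * 1 + 0 * (g - gfun N - gfun M)) * 1 + 0 * (\<rho> * ((g - gfun N - gfun M) * 1)))
      + \<rho> * (0 * (g - gfun N - (gfun L - gfun C)) + (\<sigma> - dN - (dL - dC)) * k))
    (0 + 0 + 0 + \<rho> * ((gfun N - 1) * 0 + gfun A * (0 + 0)) + s * (\<rho> * (e + 0 + 0))
      + \<rho> * (1 * (\<rho> * (1 * (e + 0 + 0) + (g - gfun N - gfun M) * 0)) + \<rho> * ((g - gfun N - gfun M) * 1) * 0)
      + \<rho> * ((g - gfun N - (gfun L - gfun C)) * 0 + k * (e + 0 + (0 + 0))))"
    by (intro has_union has_diff has_rhds has_imps has_boxes has_L has_C has_N has_A has_M has_T has_bot assms C_subset N M L)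
      (use disj M_subset_A X_subset_N T_subset in \<open>auto simp: binary_def boxes_def C_def\<close>)
  then show ?thesis unfolding G_decomp[symmetric] by (auto simp: algebra_simps intro!: exI)
qed

lemma rho_bound: "\<rho> * (1 + k) \<le> 1/8"
proof -
  have "(1 - s * \<rho>)\<^sup>2 \<le> 1" using s_rho by (intro power_le_one) auto
  then show ?thesis using discriminant by (simp add: algebra_simps)
qed

lemma G_coefficient: "0 \<le> s * \<rho> + \<rho> * \<rho> + \<rho> * k" "s * \<rho> + \<rho> * \<rho> + \<rho> * k < 1"
proof -
  have "s * \<rho> \<le> \<rho>" using rho by auto
  moreover have "\<rho> * \<rho> \<le> \<rho> * 1" using rho by (intro mult_left_mono) auto
  moreover have "0 \<le> \<rho> * k" using rho by simp
  moreover have "\<rho> + \<rho> * k \<le> 1/8" using rho_bound by (simp add: algebra_simps)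
  ultimately show "s * \<rho> + \<rho> * \<rho> + \<rho> * k < 1" using rho by linarith
  show "0 \<le> s * \<rho> + \<rho> * \<rho> + \<rho> * k" using rho by simp
qed

theorem density_G: "has_density F G dG"
proof -
  have "dG * (1 - s * \<rho> - \<rho> * \<rho> - \<rho> * k) = dL - dC + dN + \<rho> * (dA * (gfun N - 1) + dN * gfun A)
         - (s * \<rho> + \<rho> * \<rho>) * (dN + dM) - \<rho> * (k * (dN + dL - dC))"
    using G_coefficient unfolding dG_def by simp
  then have fix_G: "dL - dC + dN + \<rho> * (dA * (gfun N - 1) + dN * gfun A) + (s * \<rho> + \<rho> * \<rho>) * (dG - dN - dM)
            + \<rho> * (k * (dG - dN - (dL - dC))) = dG" by (simp add: algebra_simps)
  have "close (count G) dG 0"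
  proof (rule close_contraction[OF dominated_count[OF G_subset] G_coefficient])
    fix e assume "0 \<le> e" "close (count G) dG e"
    then have "has G (gfun G) dG e" using G_subset by (simp add: has_def)
    from has_G_step[OF this] show "close (count G) dG ((s * \<rho> + \<rho> * \<rho> + \<rho> * k) * e)"
      unfolding fix_G by (auto simp: has_def)
  qed
  then have "(\<lambda>n. count G n / count F n) \<longlonglongrightarrow> dG" by (simp add: close_def near_zero_iff)
  moreover have "G \<inter> level F n = level G n" for n using G_subset by (auto simp: level_def)
  ultimately show ?thesis by (simp add: has_density_def count_def)
qed

end

section \<open>Rational enclosures\<close>

definition enclosed :: "real \<Rightarrow> real \<Rightarrow> real \<Rightarrow> bool" where
  "enclosed x l u \<longleftrightarrow> l \<le> x \<and> x \<le> u"

named_theorems enclosed_intros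

text \<open>Interval arithmetic produces exact rational end points; outward rounding keeps them
  short.\<close>

lemma enclosed_weaken: "enclosed x l u \<Longrightarrow> l' \<le> l \<Longrightarrow> u \<le> u' \<Longrightarrow> enclosed x l' u'"
  unfolding enclosed_def by linarith

lemma enclosed_const [enclosed_intros]:
  "enclosed (numeral n) (numeral n) (numeral n)" "enclosed 1 1 1"
  "enclosed (of_bool True) 1 1" "enclosed (of_bool False) 0 0"
  "enclosed (real (card {})) 0 0" "enclosed (real (card {x})) 1 1"
  unfolding enclosed_def by auto

lemma enclosed_add [enclosed_intros]: "enclosed x l u \<Longrightarrow> enclosed y l' u' \<Longrightarrow> enclosed (x + y) (l + l') (u + u')"
  unfolding enclosed_def by linarith

lemma enclosed_diff [enclosed_intros]: "enclosed x l u \<Longrightarrow> enclosed y l' u' \<Longrightarrow> enclosed (x - y) (l - u') (u - l')"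
  unfolding enclosed_def by linarith

lemma enclosed_mult [enclosed_intros]:
  "enclosed x l u \<Longrightarrow> enclosed y l' u' \<Longrightarrow> 0 \<le> l \<Longrightarrow> 0 \<le> l' \<Longrightarrow> enclosed (x * y) (l * l') (u * u')"
  unfolding enclosed_def by (auto intro: mult_mono)

lemma enclosed_divide [enclosed_intros]:
  "enclosed x l u \<Longrightarrow> enclosed y l' u' \<Longrightarrow> 0 \<le> l \<Longrightarrow> 0 < l' \<Longrightarrow> enclosed (x / y) (l / u') (u / l')"
  unfolding enclosed_def by (auto intro: frac_le)

text \<open>The right-hand side at \<open>x\<close> minus \<open>x\<close> factors as
  \<open>x - z\<close> times a negative number. Its sign tells on which side of the root
  \<open>x\<close> lies, so a candidate bound is verified by one evaluation, without square
  roots.\<close>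

lemma quadratic_root_compare:
  fixes r f z x :: real
  assumes "z = 1 + r * ((f - z) * z)" "0 \<le> z" "0 \<le> x" "0 \<le> r" "r * f < 1"
  shows "x \<le> 1 + r * ((f - x) * x) \<Longrightarrow> x \<le> z" "1 + r * ((f - x) * x) \<le> x \<Longrightarrow> z \<le> x"
proof -
  have "0 \<le> r * x" "0 \<le> r * z" using assms by simp_all
  then have neg: "r * f - r * x - r * z - 1 < 0" using assms(5) by linarith
  have "(1 + r * ((f - x) * x)) - x = (x - z) * (r * f - r * x - r * z - 1)"
    using assms(1) by algebra
  then have "x \<le> 1 + r * ((f - x) * x) \<longleftrightarrow> 0 \<le> (x - z) * (r * f - r * x - r * z - 1)"
    "1 + r * ((f - x) * x) \<le> x \<longleftrightarrow> (x - z) * (r * f - r * x - r * z - 1) \<le> 0" by linarith+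
  then show "x \<le> 1 + r * ((f - x) * x) \<Longrightarrow> x \<le> z" "1 + r * ((f - x) * x) \<le> x \<Longrightarrow> z \<le> x"
    using neg by (auto simp: zero_le_mult_iff mult_le_0_iff)
qed

section \<open>Locating the roots for \<open>N\<close>, \<open>C\<close> and
  \<open>L\<close>\<close>

context grammar
begin

lemma gfun_F_eq: "gfun F = (1 - s * \<rho>) / (4 * \<rho>)"
  using gfun_F rho by (simp add: field_simps)

lemma enclosed_N:
  assumes "enclosed (1 + \<rho> * ((gfun F - l) * l)) l1 u1" "enclosed (1 + \<rho> * ((gfun F - u) * u)) l2 u2"
    and "l \<le> l1" "u2 \<le> u" "0 \<le> l" "0 \<le> u"
  shows "enclosed (gfun N) l u"
  using quadratic_root_compare[OF gfun_N gf_nonneg[OF dominated_count[OF N_subset]], of l]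
    quadratic_root_compare[OF gfun_N gf_nonneg[OF dominated_count[OF N_subset]], of u]
    rho rho_gfun_le[OF order_refl] assms
  unfolding enclosed_def by linarith

lemma enclosed_C:
  assumes "enclosed (1 + \<rho> * ((gfun L - l) * l)) l1 u1" "enclosed (1 + \<rho> * ((gfun L - u) * u)) l2 u2"
    and "l \<le> l1" "u2 \<le> u" "0 \<le> l" "0 \<le> u"
  shows "enclosed (gfun C) l u"
  using quadratic_root_compare[OF gfun_C gf_nonneg[OF dominated_count[OF C_subset(1)]], of l]
    quadratic_root_compare[OF gfun_C gf_nonneg[OF dominated_count[OF C_subset(1)]], of u]
    rho rho_gfun_le[OF L_subset] assms
  unfolding enclosed_def by linarith

text \<open>The bound 5 selects the smaller of the two roots of the quadratic equation for \<open>L\<close>.\<close>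

lemma enclosed_L:
  assumes "enclosed (1 + k + gfun B + \<rho> * (k * gfun F) + \<rho> * (l * (l - k))) l1 u1"
    and "enclosed (1 + k + gfun B + \<rho> * (k * gfun F) + \<rho> * (u * (u - k))) l2 u2"
    and "l \<le> l1" "u2 \<le> u" "l \<le> 5" "u \<le> 5"
  shows "enclosed (gfun L) l u"
proof -
  let ?h = "\<lambda>x. 1 + k + gfun B + \<rho> * (k * gfun F) + \<rho> * (x * (x - k))"
  have "(x \<le> ?h x \<longrightarrow> x \<le> gfun L) \<and> (?h x \<le> x \<longrightarrow> gfun L \<le> x)" if "x \<le> 5" for x
  proof -
    have "\<rho> * 1 \<le> \<rho> * (1 + k)" "0 \<le> \<rho> * k" using rho by auto
    then have "\<rho> \<le> 1/8" using rho_bound by linarith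
    then have "\<rho> * 5 \<le> 5/8" by linarith
    moreover have "\<rho> * x \<le> \<rho> * 5" using that rho by simp
    \<comment> \<open>The total is below 1 because \<open>5/8 + 1/4 < 1\<close>.\<close>
    ultimately have neg: "\<rho> * x + \<rho> * gfun L - \<rho> * k - 1 < 0"
      using \<open>0 \<le> \<rho> * k\<close> rho_gfun_le[OF L_subset] by linarith
    have "?h x - x = (x - gfun L) * (\<rho> * x + \<rho> * gfun L - \<rho> * k - 1)"
      using gfun_L by algebra
    then have "x \<le> ?h x \<longleftrightarrow> 0 \<le> (x - gfun L) * (\<rho> * x + \<rho> * gfun L - \<rho> * k - 1)"
      "?h x \<le> x \<longleftrightarrow> (x - gfun L) * (\<rho> * x + \<rho> * gfun L - \<rho> * k - 1) \<le> 0" by linarith+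
    then show ?thesis using neg by (auto simp: zero_le_mult_iff mult_le_0_iff)
  qed
  from this[of l] this[of u] assms show ?thesis unfolding enclosed_def by auto
qed

end

section \<open>The three alphabets\<close>

lemmas class_simps = boxes_def binary_def

interpretation ir: grammar False "{}" F_ir A_ir N_ir M_ir X_ir B_ir L_ir G_ir "1/8"
proof
  show "F_ir = {\<^bold>\<bottom>} \<union> {} \<union> boxes False F_ir \<union> imps F_ir F_ir \<union> rhds F_ir F_ir"
    by (rule set_eqI, subst F_ir.simps) (auto simp: class_simps)
  show "A_ir = {} \<union> boxes False F_ir \<union> imps N_ir F_ir \<union> imps F_ir A_ir \<union> rhds F_ir F_ir"
    by (rule set_eqI, subst A_ir.simps) (auto simp: class_simps)
  show "N_ir = {\<^bold>\<bottom>} \<union> imps A_ir N_ir"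
    by (rule set_eqI, subst N_ir.simps) (auto simp: class_simps)
  show "M_ir = boxes False N_ir \<union> rhds A_ir N_ir"
    by (rule set_eqI, subst M_ir.simps) (auto simp: class_simps)
  show "X_ir = imps M_ir {\<^bold>\<bottom>}"
    by (rule set_eqI, subst X_ir.simps) (auto simp: class_simps)
  show "B_ir = boxes False N_ir \<union> boxes False M_ir \<union> rhds {\<^bold>\<bottom>} F_ir \<union> rhds F_ir A_ir \<union> rhds A_ir {\<^bold>\<bottom>}
      \<union> rhds N_ir X_ir \<union> rhds X_ir {\<^bold>\<bottom>}"
    by (rule set_eqI, subst B_ir.simps) (auto simp: class_simps)
  show "L_ir = {\<^bold>\<bottom>} \<union> {} \<union> B_ir \<union> imps F_ir {} \<union> imps L_ir L_ir"
    by (rule set_eqI, subst L_ir.simps) (auto simp: class_simps)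
  show "G_ir = L_ir \<union> N_ir \<union> M_ir \<union> boxes False G_ir \<union> rhds (imps G_ir {\<^bold>\<bottom>}) {\<^bold>\<bottom>} \<union> imps {} G_ir"
    by (rule set_eqI, subst G_ir.simps) (auto simp: class_simps)
qed auto

text \<open>The smaller root of \<open>(1 - x)^2 = 8 x\<close>, that is, of
  \<open>x^2 - 10 x + 1 = 0\<close>.\<close>

interpretation irb: grammar True "{}" F_irb A_irb N_irb M_irb X_irb B_irb L_irb G_irb "5 - 2 * sqrt 6"
proof
  show "F_irb = {\<^bold>\<bottom>} \<union> {} \<union> boxes True F_irb \<union> imps F_irb F_irb \<union> rhds F_irb F_irb"
    by (rule set_eqI, subst F_irb.simps) (auto simp: class_simps)
  show "A_irb = {} \<union> boxes True F_irb \<union> imps N_irb F_irb \<union> imps F_irb A_irb \<union> rhds F_irb F_irb"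
    by (rule set_eqI, subst A_irb.simps) (auto simp: class_simps)
  show "N_irb = {\<^bold>\<bottom>} \<union> imps A_irb N_irb"
    by (rule set_eqI, subst N_irb.simps) (auto simp: class_simps)
  show "M_irb = boxes True N_irb \<union> rhds A_irb N_irb"
    by (rule set_eqI, subst M_irb.simps) (auto simp: class_simps)
  show "X_irb = imps M_irb {\<^bold>\<bottom>}"
    by (rule set_eqI, subst X_irb.simps) (auto simp: class_simps)
  show "B_irb = boxes True N_irb \<union> boxes True M_irb \<union> rhds {\<^bold>\<bottom>} F_irb \<union> rhds F_irb A_irb \<union> rhds A_irb {\<^bold>\<bottom>}
      \<union> rhds N_irb X_irb \<union> rhds X_irb {\<^bold>\<bottom>}"
    by (rule set_eqI, subst B_irb.simps) (auto simp: class_simps)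
  show "L_irb = {\<^bold>\<bottom>} \<union> {} \<union> B_irb \<union> imps F_irb {} \<union> imps L_irb L_irb"
    by (rule set_eqI, subst L_irb.simps) (auto simp: class_simps)
  show "G_irb = L_irb \<union> N_irb \<union> M_irb \<union> boxes True G_irb \<union> rhds (imps G_irb {\<^bold>\<bottom>}) {\<^bold>\<bottom>} \<union> imps {} G_irb"
    by (rule set_eqI, subst G_irb.simps) (auto simp: class_simps)
  have "2 < sqrt 6" by (rule real_less_rsqrt) simp
  moreover have "sqrt 6 < 5/2" by (rule real_less_lsqrt) (simp_all add: power2_eq_square)
  ultimately show "0 < 5 - 2 * sqrt 6" "5 - 2 * sqrt 6 < 1" by simp_all
  show "(1 - of_bool True * (5 - 2 * sqrt 6))\<^sup>2 = 8 * (1 + real (card {})) * (5 - 2 * sqrt 6)"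
    by (simp add: power2_eq_square algebra_simps)
qed auto

text \<open>With two atoms the equation is \<open>(1 - x)^2 = 16 x\<close>, that is,
  \<open>x^2 - 18 x + 1 = 0\<close>.\<close>

interpretation tirb: grammar True "{\<^bold>\<top>}" F_tirb A_tirb N_tirb M_tirb X_tirb B_tirb L_tirb G_tirb "9 - 4 * sqrt 5"
proof
  show "F_tirb = {\<^bold>\<bottom>} \<union> {\<^bold>\<top>} \<union> boxes True F_tirb \<union> imps F_tirb F_tirb \<union> rhds F_tirb F_tirb"
    by (rule set_eqI, subst F_tirb.simps) (auto simp: class_simps)
  show "A_tirb = {\<^bold>\<top>} \<union> boxes True F_tirb \<union> imps N_tirb F_tirb \<union> imps F_tirb A_tirb \<union> rhds F_tirb F_tirb"
    by (rule set_eqI, subst A_tirb.simps) (auto simp: class_simps)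
  show "N_tirb = {\<^bold>\<bottom>} \<union> imps A_tirb N_tirb"
    by (rule set_eqI, subst N_tirb.simps) (auto simp: class_simps)
  show "M_tirb = boxes True N_tirb \<union> rhds A_tirb N_tirb"
    by (rule set_eqI, subst M_tirb.simps) (auto simp: class_simps)
  show "X_tirb = imps M_tirb {\<^bold>\<bottom>}"
    by (rule set_eqI, subst X_tirb.simps) (auto simp: class_simps)
  show "B_tirb = boxes True N_tirb \<union> boxes True M_tirb \<union> rhds {\<^bold>\<bottom>} F_tirb \<union> rhds F_tirb A_tirb \<union> rhds A_tirb {\<^bold>\<bottom>}
      \<union> rhds N_tirb X_tirb \<union> rhds X_tirb {\<^bold>\<bottom>}"
    by (rule set_eqI, subst B_tirb.simps) (auto simp: class_simps)
  show "L_tirb = {\<^bold>\<bottom>} \<union> {\<^bold>\<top>} \<union> B_tirb \<union> imps F_tirb {\<^bold>\<top>} \<union> imps L_tirb L_tirb"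
    by (rule set_eqI, subst L_tirb.simps) (auto simp: class_simps)
  show "G_tirb = L_tirb \<union> N_tirb \<union> M_tirb \<union> boxes True G_tirb \<union> rhds (imps G_tirb {\<^bold>\<bottom>}) {\<^bold>\<bottom>} \<union> imps {\<^bold>\<top>} G_tirb"
    by (rule set_eqI, subst G_tirb.simps) (auto simp: class_simps)
  have "2 < sqrt 5" by (rule real_less_rsqrt) simp
  moreover have "sqrt 5 < 9/4" by (rule real_less_lsqrt) (simp_all add: power2_eq_square)
  ultimately show "0 < 9 - 4 * sqrt 5" "9 - 4 * sqrt 5 < 1" by simp_all
  show "(1 - of_bool True * (9 - 4 * sqrt 5))\<^sup>2 = 8 * (1 + real (card {\<^bold>\<top>})) * (9 - 4 * sqrt 5)"
    by (simp add: power2_eq_square algebra_simps)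
qed auto

section \<open>Numerical values of the densities\<close>

lemma ir_dG: "enclosed ir.dG 0.93771 0.937719"
proof -
  have [enclosed_intros]: "enclosed (1/8 :: real) (1/8) (1/8)" by (simp add: enclosed_def)
  \<comment> \<open>The quantities follow in order of dependence, each enclosure feeding the later
    ones. The widths grow along the way but stay below 10^-7, ample for five decimals.\<close>
  have [enclosed_intros]: "enclosed (ir.gfun F_ir) 2.0000000000000 2.0000000000000"
    unfolding ir.gfun_F_eq by (rule enclosed_weaken) (rule enclosed_intros | simp)+
  have [enclosed_intros]: "enclosed (ir.gfun N_ir) 1.1231056256173 1.1231056256180"
    by (rule ir.enclosed_N) (rule enclosed_intros | simp)+
  have [enclosed_intros]: "enclosed (ir.gfun A_ir) 0.8768943743817 0.8768943743830"
    unfolding ir.gfun_A by (rule enclosed_weaken) (rule enclosed_intros | simp)+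
  have [enclosed_intros]: "enclosed (ir.gfun M_ir) 0.1231056256166 0.1231056256187"
    unfolding ir.gfun_M by (rule enclosed_weaken) (rule enclosed_intros | simp)+
  have [enclosed_intros]: "enclosed (ir.gfun X_ir) 0.0153882032012 0.0153882032033"
    unfolding ir.gfun_X by (rule enclosed_weaken) (rule enclosed_intros | simp)+
  have [enclosed_intros]: "enclosed (ir.gfun B_ir) 0.4713839157896 0.4713839157977"
    unfolding ir.gfun_B by (rule enclosed_weaken) (rule enclosed_intros | simp)+
  have [enclosed_intros]: "enclosed (ir.gfun L_ir) 1.9435640847056 1.9435640847357"
    by (rule ir.enclosed_L) (rule enclosed_intros | simp)+
  have [enclosed_intros]: "enclosed (ir.gfun ir.C) 1.1154644624696 1.1154644625297"
    by (rule ir.enclosed_C) (rule enclosed_intros | simp)+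
  have [enclosed_intros]: "enclosed (ir.dN) 0.1361965622 0.1361965627"
    unfolding ir.dN_def by (rule enclosed_weaken) (rule enclosed_intros | simp)+
  have [enclosed_intros]: "enclosed (ir.dA) 0.8638034371 0.8638034380"
    unfolding ir.dA_def by (rule enclosed_weaken) (rule enclosed_intros | simp)+
  have [enclosed_intros]: "enclosed (ir.dM) 0.1361965614 0.1361965635"
    unfolding ir.dM_def by (rule enclosed_weaken) (rule enclosed_intros | simp)+
  have [enclosed_intros]: "enclosed (ir.dX) 0.0170245693 0.0170245714"
    unfolding ir.dX_def by (rule enclosed_weaken) (rule enclosed_intros | simp)+
  have [enclosed_intros]: "enclosed (ir.dB) 0.4532146785 0.4532146866"
    unfolding ir.dB_def by (rule enclosed_weaken) (rule enclosed_intros | simp)+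
  have [enclosed_intros]: "enclosed (ir.dL) 0.8815536996 0.8815537397"
    unfolding ir.dL_def by (rule enclosed_weaken) (rule enclosed_intros | simp)+
  have [enclosed_intros]: "enclosed (ir.dC) 0.1186555315 0.1186555716"
    unfolding ir.dC_def by (rule enclosed_weaken) (rule enclosed_intros | simp)+
  show ?thesis unfolding ir.dG_def by (rule enclosed_weaken) (rule enclosed_intros | simp)+
qed

text \<open>The value is about 0.8665391, roughly one millionth below 0.86654, so the upper end
  needs one digit more than for the other alphabets.\<close>

lemma irb_dG: "enclosed irb.dG 0.86653 0.8665395"
proof -
  have [enclosed_intros]: "enclosed (sqrt 6) 2.44948974278317809 2.44948974278317810"
    unfolding enclosed_def by (intro conjI real_le_rsqrt real_le_lsqrt) (simp_all add: power2_eq_square)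
  have [enclosed_intros]: "enclosed (5 - 2 * sqrt 6) 0.101020514433643 0.101020514433644"
    by (rule enclosed_weaken) (rule enclosed_intros | simp)+
  have [enclosed_intros]: "enclosed (irb.gfun F_irb) 2.2247448713915 2.2247448713916"
    unfolding irb.gfun_F_eq by (rule enclosed_weaken) (rule enclosed_intros | simp)+
  have [enclosed_intros]: "enclosed (irb.gfun N_irb) 1.1249839327013 1.1249839327020"
    by (rule irb.enclosed_N) (rule enclosed_intros | simp)+
  have [enclosed_intros]: "enclosed (irb.gfun A_irb) 1.0997609386893 1.0997609386906"
    unfolding irb.gfun_A by (rule enclosed_weaken) (rule enclosed_intros | simp)+
  have [enclosed_intros]: "enclosed (irb.gfun M_irb) 0.2386303883117 0.2386303883138"
    unfolding irb.gfun_M by (rule enclosed_weaken) (rule enclosed_intros | simp)+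
  have [enclosed_intros]: "enclosed (irb.gfun X_irb) 0.0241065645858 0.0241065645879"
    unfolding irb.gfun_X by (rule enclosed_weaken) (rule enclosed_intros | simp)+
  have [enclosed_intros]: "enclosed (irb.gfun B_irb) 0.6124031479351 0.6124031479432"
    unfolding irb.gfun_B by (rule enclosed_weaken) (rule enclosed_intros | simp)+
  have [enclosed_intros]: "enclosed (irb.gfun L_irb) 2.0277945105436 2.0277945105737"
    by (rule irb.enclosed_L) (rule enclosed_intros | simp)+
  have [enclosed_intros]: "enclosed (irb.gfun irb.C) 1.1030449982616 1.1030449983217"
    by (rule irb.enclosed_C) (rule enclosed_intros | simp)+
  have [enclosed_intros]: "enclosed (irb.dN) 0.1133576156 0.1133576161"
    unfolding irb.dN_def by (rule enclosed_weaken) (rule enclosed_intros | simp)+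
  have [enclosed_intros]: "enclosed (irb.dA) 0.8866423837 0.8866423846"
    unfolding irb.dA_def by (rule enclosed_weaken) (rule enclosed_intros | simp)+
  have [enclosed_intros]: "enclosed (irb.dM) 0.1248090595 0.1248090616"
    unfolding irb.dM_def by (rule enclosed_weaken) (rule enclosed_intros | simp)+
  have [enclosed_intros]: "enclosed (irb.dX) 0.0126082745 0.0126082766"
    unfolding irb.dX_def by (rule enclosed_weaken) (rule enclosed_intros | simp)+
  have [enclosed_intros]: "enclosed (irb.dB) 0.4371559157 0.4371559238"
    unfolding irb.dB_def by (rule enclosed_weaken) (rule enclosed_intros | simp)+
  have [enclosed_intros]: "enclosed (irb.dL) 0.7405627591 0.7405627992"
    unfolding irb.dL_def by (rule enclosed_weaken) (rule enclosed_intros | simp)+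
  have [enclosed_intros]: "enclosed (irb.dC) 0.0810609882 0.0810610283"
    unfolding irb.dC_def by (rule enclosed_weaken) (rule enclosed_intros | simp)+
  show ?thesis unfolding irb.dG_def by (rule enclosed_weaken) (rule enclosed_intros | simp)+
qed

lemma tirb_dG: "enclosed tirb.dG 0.90519 0.905199"
proof -
  have [enclosed_intros]: "enclosed (sqrt 5) 2.23606797749978969 2.23606797749978970"
    unfolding enclosed_def by (intro conjI real_le_rsqrt real_le_lsqrt) (simp_all add: power2_eq_square)
  have [enclosed_intros]: "enclosed (9 - 4 * sqrt 5) 0.055728090000841 0.055728090000842"
    by (rule enclosed_weaken) (rule enclosed_intros | simp)+
  have [enclosed_intros]: "enclosed (tirb.gfun F_tirb) 4.2360679774997 4.2360679774998"
    unfolding tirb.gfun_F_eq by (rule enclosed_weaken) (rule enclosed_intros | simp)+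
  have [enclosed_intros]: "enclosed (tirb.gfun N_tirb) 1.2033781406908 1.2033781406915"
    by (rule tirb.enclosed_N) (rule enclosed_intros | simp)+
  have [enclosed_intros]: "enclosed (tirb.gfun A_tirb) 3.0326898368080 3.0326898368093"
    unfolding tirb.gfun_A by (rule enclosed_weaken) (rule enclosed_intros | simp)+
  have [enclosed_intros]: "enclosed (tirb.gfun M_tirb) 0.2704401060196 0.2704401060217"
    unfolding tirb.gfun_M by (rule enclosed_weaken) (rule enclosed_intros | simp)+
  have [enclosed_intros]: "enclosed (tirb.gfun X_tirb) 0.0150711105671 0.0150711105692"
    unfolding tirb.gfun_X by (rule enclosed_weaken) (rule enclosed_intros | simp)+
  have [enclosed_intros]: "enclosed (tirb.gfun B_tirb) 1.0351327078474 1.0351327078555"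
    unfolding tirb.gfun_B by (rule enclosed_weaken) (rule enclosed_intros | simp)+
  have [enclosed_intros]: "enclosed (tirb.gfun L_tirb) 3.9023922463496 3.9023922463797"
    by (rule tirb.enclosed_L) (rule enclosed_intros | simp)+
  have [enclosed_intros]: "enclosed (tirb.gfun tirb.C) 1.1789301690733 1.1789301691334"
    by (rule tirb.enclosed_C) (rule enclosed_intros | simp)+
  have [enclosed_intros]: "enclosed (tirb.dN) 0.0746745956 0.0746745961"
    unfolding tirb.dN_def by (rule enclosed_weaken) (rule enclosed_intros | simp)+
  have [enclosed_intros]: "enclosed (tirb.dA) 0.9253254037 0.9253254046"
    unfolding tirb.dA_def by (rule enclosed_weaken) (rule enclosed_intros | simp)+
  have [enclosed_intros]: "enclosed (tirb.dM) 0.0788360674 0.0788360695"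
    unfolding tirb.dM_def by (rule enclosed_weaken) (rule enclosed_intros | simp)+
  have [enclosed_intros]: "enclosed (tirb.dX) 0.0043933825 0.0043933846"
    unfolding tirb.dX_def by (rule enclosed_weaken) (rule enclosed_intros | simp)+
  have [enclosed_intros]: "enclosed (tirb.dB) 0.4520859979 0.4520860060"
    unfolding tirb.dB_def by (rule enclosed_weaken) (rule enclosed_intros | simp)+
  have [enclosed_intros]: "enclosed (tirb.dL) 0.8180227313 0.8180227714"
    unfolding tirb.dL_def by (rule enclosed_weaken) (rule enclosed_intros | simp)+
  have [enclosed_intros]: "enclosed (tirb.dC) 0.0588052842 0.0588053243"
    unfolding tirb.dC_def by (rule enclosed_weaken) (rule enclosed_intros | simp)+
  show ?thesis unfolding tirb.dG_def by (rule enclosed_weaken) (rule enclosed_intros | simp)+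
qed

theorem theorem2:
  shows "(\<exists>\<mu>. has_density F_ir G_ir \<mu> \<and> 0.93771 \<le> \<mu> \<and> \<mu> < 0.93772) \<and>
         (\<exists>\<mu>. has_density F_irb G_irb \<mu> \<and> 0.86653 \<le> \<mu> \<and> \<mu> < 0.86654) \<and>
         (\<exists>\<mu>. has_density F_tirb G_tirb \<mu> \<and> 0.90519 \<le> \<mu> \<and> \<mu> < 0.90520)"
proof (intro conjI)
  show "\<exists>\<mu>. has_density F_ir G_ir \<mu> \<and> 0.93771 \<le> \<mu> \<and> \<mu> < 0.93772"
    using ir.density_G ir_dG unfolding enclosed_def by (intro exI[of _ ir.dG]) simp
  show "\<exists>\<mu>. has_density F_irb G_irb \<mu> \<and> 0.86653 \<le> \<mu> \<and> \<mu> < 0.86654"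
    using irb.density_G irb_dG unfolding enclosed_def by (intro exI[of _ irb.dG]) simp
  show "\<exists>\<mu>. has_density F_tirb G_tirb \<mu> \<and> 0.90519 \<le> \<mu> \<and> \<mu> < 0.90520"
    using tirb.density_G tirb_dG unfolding enclosed_def by (intro exI[of _ tirb.dG]) simp
qed

end
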